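(* For every prime $p$, the set $\mathcal R_p$ of quadratic residues modulo $p$ (the set of nonzero squares in $\mathbb F_p$, i.e. $\mu_{(p-1)/2}$ for odd $p$) cannot be written as $A+B=\{a+b:a\in A,b\in B\}$ with $A,B\subseteq\mathbb F_p$ and $|A|,|B|>1$. *)

theory Defs
  imports
    "Berlekamp_Zassenhaus.Finite_Field"
    "HOL-Library.Set_Algebras"
begin

text \<open>The prime field with p elements is \<open>'p mod_ring\<close> where \<open>'p :: prime_card\<close>, so that
  p is the prime \<open>CARD('p)\<close>.  Zero is not counted as a quadratic residue.\<close>

definition quadratic_residues :: "'p::prime_card mod_ring set" where
  "quadratic_residues = {x. x \<noteq> 0 \<and> (\<exists>y. x = y\<^sup>2)}"

end

theory Submission
  imports Defs "HOL-Computational_Algebra.Polynomial"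
begin

text \<open>
  Let \<open>f\<close> and \<open>g\<close> be the monic polynomials with root sets \<open>X = -A\<close> and \<open>B\<close>, let \<open>n = |A|\<close>, \<open>m = |B|\<close>
  and \<open>d = (p - 1)/2\<close>.  The Stepanov polynomial of Hanson and Petridis,
  \<open>F = \<Sum> c(r) (x - r)^(n - 1 + d) - const\<close> with Lagrange weights \<open>c(r)\<close>, has degree \<open>d\<close> and vanishes
  to order \<open>n\<close> on \<open>B\<close>.  Hence \<open>n m = d\<close>, all sums \<open>a + b\<close> are distinct, and \<open>F\<close> is a multiple of \<open>g^n\<close>.

  Comparing the Taylor coefficients of \<open>F\<close> and \<open>g^n\<close> of order \<open>n + 1, n + 2, n + 3\<close> at a root of \<open>g\<close>
  relates the derivatives of \<open>f\<close> and \<open>g\<close> there; exchanging \<open>A\<close> and \<open>B\<close> gives the same at the roots of \<open>f\<close>.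
  The first of these relations shows that \<open>n(n+1) f g'' + 3 f' g' + m(m+1) f'' g\<close> vanishes at all \<open>n + m\<close>
  roots of \<open>f g\<close>; its degree is too small, so it is zero.  The second relation yields in the same way a
  bilinear identity of third order.  The derivatives of these two identities and the third relation are three
  linear equations for \<open>g''''/g'\<close>, \<open>f'''/f\<close> and \<open>(g''/g')^3\<close> at the roots of \<open>g\<close>.  As \<open>g''\<close> cannot vanish
  at all of them, the determinant is zero, which for \<open>n > 3\<close> and \<open>m \<ge> 3\<close> means
  \<open>4 n^4 + 2 n^3 - 10 n^2 - 4 n - 1 = 0\<close> modulo \<open>p\<close>.  Together with the same equation for \<open>m\<close> and
  \<open>2 n m = -1\<close> this forces \<open>n + m = 2\<close> modulo \<open>p\<close>, which is impossible; if \<open>n = 3\<close>, the equation for \<open>m\<close>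
  alone is contradictory.

  If \<open>m = 2\<close>, then after scaling the residues or the nonresidues split into pairs \<open>{x, x + 1}\<close>; the former
  contradicts the number of consecutive residues, the latter the multiplicativity of the Legendre symbol on
  \<open>1, \<dots>, 16\<close>.  If \<open>n = m = 3\<close>, then \<open>p = 19\<close> and the power sums of the residues force \<open>0 \<in> A + B\<close>.
\<close>

section \<open>The polynomial of Hanson and Petridis\<close>

definition root_poly :: "'a::comm_ring_1 set \<Rightarrow> 'a poly" where
  "root_poly X = (\<Prod>r\<in>X. [:- r, 1:])"

text \<open>For finite \<open>X\<close> this is 1/f'(r) with f = \<open>root_poly X\<close>, the
  residue of 1/f at its simple root r.\<close>

definition lagrange_weight :: "'a::field set \<Rightarrow> 'a \<Rightarrow> 'a" where
  "lagrange_weight X r = inverse (\<Prod>s\<in>X - {r}. r - s)"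

lemma poly_root_poly: "poly (root_poly X) x = (\<Prod>r\<in>X. x - r)"
  by (simp add: root_poly_def poly_prod)

lemma degree_root_poly [simp]: "degree (root_poly X) = card X" for X :: "'a::field set"
  unfolding root_poly_def by (subst degree_prod_sum_eq) auto

lemma lead_coeff_root_poly [simp]: "coeff (root_poly X) (card X) = 1" for X :: "'a::field set"
proof -
  have "lead_coeff (root_poly X) = 1"
    unfolding root_poly_def lead_coeff_prod by simp
  then show ?thesis by simp
qed

lemma root_poly_nonzero [simp]: "root_poly X \<noteq> 0" for X :: "'a::field set"
  using lead_coeff_root_poly[of X] by (metis coeff_0 zero_neq_one)

lemma root_poly_remove:
  assumes "finite X" "r \<in> X"
  shows "root_poly X = [:- r, 1:] * root_poly (X - {r})"
  unfolding root_poly_def by (rule prod.remove[OF assms])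

lemma lagrange_interpolation:
  fixes h :: "'a::field poly"
  assumes "finite X" "degree h < card X"
  shows "h = (\<Sum>r\<in>X. smult (poly h r * lagrange_weight X r) (root_poly (X - {r})))"
proof (rule poly_eqI_degree[of X])
  fix x assume x: "x \<in> X"
  have "poly (\<Sum>r\<in>X. smult (poly h r * lagrange_weight X r) (root_poly (X - {r}))) x
      = (\<Sum>r\<in>X. poly h r * lagrange_weight X r * (\<Prod>s\<in>X - {r}. x - s))"
    by (simp add: poly_sum poly_root_poly)
  also have "\<dots> = (\<Sum>r\<in>X. if r = x then poly h x else 0)"
  proof (rule sum.cong[OF refl])
    fix r assume r: "r \<in> X"
    show "poly h r * lagrange_weight X r * (\<Prod>s\<in>X - {r}. x - s) = (if r = x then poly h x else 0)"
    proof (cases "r = x")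
      case True
      have "(\<Prod>s\<in>X - {x}. x - s) \<noteq> 0" using assms(1) by (subst prod_zero_iff) auto
      then show ?thesis using True by (simp add: lagrange_weight_def)
    next
      case False
      then have "(\<Prod>s\<in>X - {r}. x - s) = 0" using assms(1) x by (subst prod_zero_iff) auto
      then show ?thesis using False by simp
    qed
  qed
  also have "\<dots> = poly h x" using x assms(1) by simp
  finally show "poly h x = poly (\<Sum>r\<in>X. smult (poly h r * lagrange_weight X r) (root_poly (X - {r}))) x"
    by simp
next
  show "degree h < card X" by fact
  have "degree (\<Sum>r\<in>X. smult (poly h r * lagrange_weight X r) (root_poly (X - {r}))) \<le> card X - 1"
    using assms(1) by (intro degree_sum_le order.trans[OF degree_smult_le]) auto
  then show "degree (\<Sum>r\<in>X. smult (poly h r * lagrange_weight X r) (root_poly (X - {r}))) < card X"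
    using assms(2) by linarith
qed

text \<open>In the interpolation formula every \<open>root_poly (X - {r})\<close> is monic of degree
  \<open>card X - 1\<close>; the coefficients of that order are compared.\<close>

lemma sum_lagrange_weight:
  fixes h :: "'a::field poly"
  assumes "finite X" "degree h < card X"
  shows "(\<Sum>r\<in>X. lagrange_weight X r * poly h r) = coeff h (card X - 1)"
proof -
  have "coeff h (card X - 1)
      = (\<Sum>r\<in>X. poly h r * lagrange_weight X r * coeff (root_poly (X - {r})) (card X - 1))"
    by (subst lagrange_interpolation[OF assms]) (simp add: coeff_sum)
  also have "\<dots> = (\<Sum>r\<in>X. lagrange_weight X r * poly h r)"
  proof (rule sum.cong[OF refl])
    fix r assume "r \<in> X"
    then have "card X - 1 = card (X - {r})" using assms(1) by simp
    then show "poly h r * lagrange_weight X r * coeff (root_poly (X - {r})) (card X - 1)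
      = lagrange_weight X r * poly h r" by (simp del: card_Diff_singleton)
  qed
  finally show ?thesis by simp
qed

lemma lagrange_weight_moment:
  fixes X :: "'a::field set"
  assumes "finite X" "k < card X"
  shows "(\<Sum>r\<in>X. lagrange_weight X r * (b - r) ^ k) = (if k = card X - 1 then (-1) ^ k else 0)"
proof -
  have "(\<Sum>r\<in>X. lagrange_weight X r * (b - r) ^ k) = (\<Sum>r\<in>X. lagrange_weight X r * poly ([:b, -1:] ^ k) r)"
    by (simp add: poly_power)
  also have "\<dots> = coeff ([:b, -1:] ^ k) (card X - 1)"
    by (rule sum_lagrange_weight) (use assms in auto)
  also have "\<dots> = (if k = card X - 1 then (-1) ^ k else 0)"
    using assms by (auto intro!: coeff_eq_0)
  finally show ?thesis .
qed

lemma pcompose_power: "pcompose (p ^ n) q = pcompose p q ^ n" for p q :: "'a::comm_ring_1 poly"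
  by (induction n) (simp_all add: pcompose_mult pcompose_1)

section \<open>Degree and vanishing order of the auxiliary polynomial\<close>

text \<open>The weights cancel the top \<open>card X - 1\<close> coefficients of the sum, which
  lowers its degree to \<open>d\<close>. \<open>\<eta>\<close> stands for the common value of
  \<open>(b - r) ^ d\<close>; the subtracted constant is the value that the sum then takes at
  b.\<close>

definition stepanov_poly :: "'a::field set \<Rightarrow> nat \<Rightarrow> 'a \<Rightarrow> 'a poly" where
  "stepanov_poly X d \<eta> =
     (\<Sum>r\<in>X. smult (lagrange_weight X r) ([:- r, 1:] ^ (card X - 1 + d))) - [:\<eta> * (-1) ^ (card X - 1):]"

lemma coeff_shift_stepanov_poly:
  assumes "k \<le> card X - 1 + d"
  shows "coeff (pcompose (stepanov_poly X d \<eta>) [:b, 1:]) k =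
    of_nat ((card X - 1 + d) choose k) * (\<Sum>r\<in>X. lagrange_weight X r * (b - r) ^ (card X - 1 + d - k))
      - (if k = 0 then \<eta> * (-1) ^ (card X - 1) else 0)"
proof -
  have pw: "pcompose ([:- r, 1:] ^ j) [:b, 1:] = [:b - r, 1:] ^ j" for r :: 'a and j
    by (simp add: pcompose_power pcompose_pCons)
  show ?thesis
    using assms
    by (auto simp: stepanov_poly_def pcompose_diff pcompose_sum pcompose_smult pw coeff_sum
        coeff_linear_poly_power sum_distrib_left coeff_pCons mult_ac split: nat.splits)
qed

text \<open>As \<open>(b - r) ^ d\<close> does not depend on \<open>r\<close>, it factors out and
  leaves the moment of order \<open>card X - 1 - k\<close>. This is zero for k > 0, and for k = 0
  the constant cancels it.\<close>

lemma stepanov_poly_low_coeffs: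
  fixes X :: "'a::field set"
  assumes "finite X" "\<forall>r\<in>X. (b - r) ^ d = \<eta>" "k < card X"
  shows "coeff (pcompose (stepanov_poly X d \<eta>) [:b, 1:]) k = 0"
proof -
  have *: "(\<Sum>r\<in>X. lagrange_weight X r * (b - r) ^ (card X - 1 + d - k))
      = \<eta> * (\<Sum>r\<in>X. lagrange_weight X r * (b - r) ^ (card X - 1 - k))"
    unfolding sum_distrib_left
  proof (rule sum.cong[OF refl])
    fix r assume "r \<in> X"
    have "card X - 1 + d - k = d + (card X - 1 - k)" using assms(3) by simp
    then show "lagrange_weight X r * (b - r) ^ (card X - 1 + d - k)
      = \<eta> * (lagrange_weight X r * (b - r) ^ (card X - 1 - k))"
      using assms(2) \<open>r \<in> X\<close> by (simp add: power_add mult_ac)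
  qed
  have kle: "k \<le> card X - 1 + d" using assms(3) by simp
  have lt: "card X - 1 - k < card X" using assms(3) by simp
  show ?thesis
    unfolding coeff_shift_stepanov_poly[OF kle] * lagrange_weight_moment[OF assms(1) lt]
    using assms(3) by auto
qed

text \<open>The coefficient of order \<open>d + j\<close> is a binomial coefficient times the moment
  of order \<open>card X - 1 - j\<close> at 0, so j = 0 gives the leading term. The condition on
  \<open>of_nat k\<close> keeps its binomial coefficient nonzero.\<close>

lemma degree_stepanov_poly:
  fixes X :: "'a::field set"
  assumes "finite X" "X \<noteq> {}" "d > 0" and char: "\<And>k. 0 < k \<Longrightarrow> k < card X + d \<Longrightarrow> of_nat k \<noteq> (0::'a)"
  shows "degree (stepanov_poly X d \<eta>) = d"
proof -
  have n: "card X > 0" using assms by (simp add: card_gt_0_iff)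
  have c: "coeff (stepanov_poly X d \<eta>) k = of_nat ((card X - 1 + d) choose k) *
      (\<Sum>r\<in>X. lagrange_weight X r * (0 - r) ^ (card X - 1 + d - k))" if "0 < k" "k \<le> card X - 1 + d" for k
    using coeff_shift_stepanov_poly[OF that(2), of \<eta> 0] that(1) by simp
  have fact: "of_nat (fact k) \<noteq> (0::'a)" if "k < card X + d" for k
    using that
  proof (induction k)
    case (Suc k)
    then show ?case
      using char[of "Suc k"] by (simp only: fact_Suc of_nat_mult of_nat_id mult_eq_0_iff) auto
  qed simp
  have "of_nat ((card X - 1 + d) choose d) \<noteq> (0::'a)"
  proof
    assume "of_nat ((card X - 1 + d) choose d) = (0::'a)"
    then have "of_nat (fact d * fact (card X - 1 + d - d) * ((card X - 1 + d) choose d)) = (0::'a)"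
      by simp
    then show False using fact[of "card X - 1 + d"] n
      by (subst (asm) binomial_fact_lemma) auto
  qed
  moreover have mom: "(\<Sum>r\<in>X. lagrange_weight X r * (- r) ^ k) = (if k = card X - 1 then (-1) ^ k else 0)"
    if "k < card X" for k
    using lagrange_weight_moment[OF assms(1) that, of 0] by simp
  ultimately have "coeff (stepanov_poly X d \<eta>) d \<noteq> 0"
    using assms(3) n by (simp add: c)
  moreover have "coeff (stepanov_poly X d \<eta>) k = 0" if "k > d" for k
  proof (cases "k \<le> card X - 1 + d")
    case True
    then show ?thesis using that n by (simp add: c mom)
  next
    case False
    have "degree (stepanov_poly X d \<eta>) \<le> card X - 1 + d"
      unfolding stepanov_poly_def
      by (intro degree_diff_le degree_sum_le assms(1) order.trans[OF degree_smult_le])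
         (auto simp: degree_linear_power)
    then show ?thesis using False by (intro coeff_eq_0) simp
  qed
  ultimately show ?thesis
    by (intro antisym degree_le le_degree) auto
qed

lemma linear_power_dvd_of_shifted_coeffs:
  fixes p :: "'a::field poly"
  assumes "\<And>k. k < n \<Longrightarrow> coeff (pcompose p [:b, 1:]) k = 0"
  shows "[:- b, 1:] ^ n dvd p"
proof -
  have "monom 1 n dvd pcompose p [:b, 1:]"
    using assms by (simp add: monom_1_dvd_iff')
  then obtain q where "pcompose p [:b, 1:] = [:0, 1:] ^ n * q"
    by (auto simp: monom_altdef elim: dvdE)
  then have "pcompose (pcompose p [:b, 1:]) [:- b, 1:] = pcompose ([:0, 1:] ^ n * q) [:- b, 1:]"
    by simp
  moreover have "pcompose ([:0, 1:] ^ n) [:- b, 1:] = [:- b, 1:] ^ n"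
    by (simp add: pcompose_power pcompose_pCons)
  ultimately have "p = [:- b, 1:] ^ n * pcompose q [:- b, 1:]"
    by (simp add: pcompose_mult pcompose_assoc[symmetric] pcompose_pCons)
  then show ?thesis by (metis dvd_triv_left)
qed

lemma root_poly_power_dvd:
  fixes p :: "'a::field poly"
  assumes "finite B" "\<And>b. b \<in> B \<Longrightarrow> [:- b, 1:] ^ n dvd p"
  shows "root_poly B ^ n dvd p"
  using assms
proof (induction B rule: finite_induct)
  case empty
  then show ?case by (simp add: root_poly_def)
next
  case (insert b B)
  then obtain q where q: "p = root_poly B ^ n * q" by (auto elim: dvdE)
  have nz: "poly (root_poly B ^ n) b \<noteq> 0"
    using insert.hyps by (auto simp: poly_root_poly poly_power)
  show ?case
  proof (cases "p = 0")
    case False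
    then have "order b p = order b q"
      using nz q by (simp add: order_mult order_0I)
    moreover have "n \<le> order b p" using insert.prems[of b] False by (simp add: order_divides)
    ultimately have "[:- b, 1:] ^ n dvd q" by (simp add: order_divides)
    moreover have "root_poly (insert b B) ^ n = root_poly B ^ n * [:- b, 1:] ^ n"
      unfolding root_poly_def prod.insert[OF insert.hyps] power_mult_distrib by (rule mult.commute)
    ultimately show ?thesis using q by (simp only: mult_dvd_mono dvd_refl)
  qed simp
qed

text \<open>A nonzero polynomial of degree \<open>d\<close> is divisible by
  \<open>root_poly B ^ card X\<close>; comparing degrees gives the bound, and equality leaves a
  constant cofactor.\<close>

theorem card_mult_card_le_of_const_power:
  fixes X B :: "'a::field set"
  assumes "finite X" "X \<noteq> {}" "finite B" "d > 0"
    and "\<And>k. 0 < k \<Longrightarrow> k < card X + d \<Longrightarrow> of_nat k \<noteq> (0::'a)"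
    and "\<forall>b\<in>B. \<forall>r\<in>X. (b - r) ^ d = \<eta>"
  shows "card X * card B \<le> d"
    and "card X * card B = d \<Longrightarrow> \<exists>C. C \<noteq> 0 \<and> stepanov_poly X d \<eta> = smult C (root_poly B ^ card X)"
proof -
  have deg: "degree (stepanov_poly X d \<eta>) = d"
    by (rule degree_stepanov_poly) (use assms in auto)
  then have nz: "stepanov_poly X d \<eta> \<noteq> 0" using assms(4) by auto
  have "root_poly B ^ card X dvd stepanov_poly X d \<eta>"
    using assms by (intro root_poly_power_dvd linear_power_dvd_of_shifted_coeffs stepanov_poly_low_coeffs) auto
  then obtain q where q: "stepanov_poly X d \<eta> = root_poly B ^ card X * q" by (auto elim: dvdE)
  then have "q \<noteq> 0" using nz by auto
  then have d: "d = card X * card B + degree q"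
    using deg q by (simp add: degree_mult_eq degree_power_eq mult.commute)
  then show "card X * card B \<le> d" by simp
  assume "card X * card B = d"
  then obtain C where "q = [:C:]" using d by (metis add_cancel_left_right degree_eq_zeroE)
  then show "\<exists>C. C \<noteq> 0 \<and> stepanov_poly X d \<eta> = smult C (root_poly B ^ card X)"
    using q \<open>q \<noteq> 0\<close> by (intro exI[of _ C]) (auto simp: mult.commute)
qed

section \<open>Taylor coefficients at the roots\<close>

text \<open>Expansions are computed after moving b to 0, whereas the differential identities speak
  of derivatives at b; this translates between the two.\<close>

lemma taylor_shift:
  fixes p :: "'a::field poly" and b :: 'a
  defines "q \<equiv> pcompose p [:b, 1:]"
  shows "poly p b = coeff q 0"
    and "poly (pderiv p) b = coeff q 1"
    and "poly (pderiv (pderiv p)) b = 2 * coeff q 2"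
    and "poly (pderiv (pderiv (pderiv p))) b = 6 * coeff q 3"
    and "poly (pderiv (pderiv (pderiv (pderiv p)))) b = 24 * coeff q 4"
proof -
  have z: "poly r b = coeff (pcompose r [:b, 1:]) 0" for r by simp
  have d: "pcompose (pderiv r) [:b, 1:] = pderiv (pcompose r [:b, 1:])" for r
    by (simp add: pderiv_pcompose pderiv_pCons)
  show "poly p b = coeff q 0"
    "poly (pderiv p) b = coeff q 1"
    "poly (pderiv (pderiv p)) b = 2 * coeff q 2"
    "poly (pderiv (pderiv (pderiv p))) b = 6 * coeff q 3"
    "poly (pderiv (pderiv (pderiv (pderiv p)))) b = 24 * coeff q 4"
    unfolding q_def z d by (simp_all add: coeff_pderiv eval_nat_numeral)
qed

text \<open>The factors 2 and 6 clear the denominators of the binomial coefficients, so the formulas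
  follow by induction in every characteristic.\<close>

lemma coeff_power_low:
  fixes q :: "'a::field poly"
  assumes "coeff q 0 = 1"
  shows "coeff (q ^ n) 0 = 1"
    and "coeff (q ^ n) 1 = of_nat n * coeff q 1"
    and "2 * coeff (q ^ n) 2 = 2 * of_nat n * coeff q 2 + of_nat n * (of_nat n - 1) * coeff q 1 ^ 2"
    and "6 * coeff (q ^ n) 3 = 6 * of_nat n * coeff q 3 + 6 * of_nat n * (of_nat n - 1) * coeff q 1 * coeff q 2
      + of_nat n * (of_nat n - 1) * (of_nat n - 2) * coeff q 1 ^ 3"
proof -
  have m: "coeff (q * r) 0 = coeff r 0" "coeff (q * r) 1 = coeff r 1 + coeff q 1 * coeff r 0"
    "coeff (q * r) 2 = coeff r 2 + coeff q 1 * coeff r 1 + coeff q 2 * coeff r 0"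
    "coeff (q * r) 3 = coeff r 3 + coeff q 1 * coeff r 2 + coeff q 2 * coeff r 1 + coeff q 3 * coeff r 0"
    for r using assms by (simp_all add: coeff_mult eval_nat_numeral)
  show 0: "coeff (q ^ n) 0 = 1" for n
    by (induction n) (simp_all only: power_Suc power_0 m, simp_all)
  show 1: "coeff (q ^ n) 1 = of_nat n * coeff q 1" for n
    by (induction n) (simp_all only: power_Suc power_0 m 0, simp_all add: algebra_simps)
  show 2: "2 * coeff (q ^ n) 2 = 2 * of_nat n * coeff q 2 + of_nat n * (of_nat n - 1) * coeff q 1 ^ 2" for n
  proof (induction n)
    case (Suc n)
    have "2 * coeff (q ^ Suc n) 2 = 2 * coeff (q ^ n) 2 + 2 * (coeff q 1 * coeff (q ^ n) 1) + 2 * coeff q 2"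
      unfolding power_Suc m 0 by (simp add: algebra_simps)
    then show ?case unfolding Suc 1 by (simp add: algebra_simps power2_eq_square)
  qed simp
  show "6 * coeff (q ^ n) 3 = 6 * of_nat n * coeff q 3 + 6 * of_nat n * (of_nat n - 1) * coeff q 1 * coeff q 2
      + of_nat n * (of_nat n - 1) * (of_nat n - 2) * coeff q 1 ^ 3"
  proof (induction n)
    case (Suc n)
    have "6 * coeff (q ^ Suc n) 3 = 6 * coeff (q ^ n) 3 + 3 * coeff q 1 * (2 * coeff (q ^ n) 2)
        + 6 * coeff q 2 * coeff (q ^ n) 1 + 6 * coeff q 3"
      unfolding power_Suc m 0 by (simp add: algebra_simps)
    then show ?case unfolding Suc 1 2 by (simp add: algebra_simps power2_eq_square power3_eq_cube)
  qed simp
qed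

text \<open>By partial fractions 1/f(b + x) is the sum of c(r)/(b - r + x), whose coefficient of x^i
  is (-1)^i \<open>S (i + 1)\<close>. The equations are the coefficients of order 0 to 3 in the
  product of f(b + x) with this series, which is 1.\<close>

lemma reciprocal_power_sums:
  fixes X :: "'a::field set"
  assumes "finite X" "X \<noteq> {}" "b \<notin> X"
  defines "\<phi> \<equiv> pcompose (root_poly X) [:b, 1:]"
    and "S \<equiv> \<lambda>j. \<Sum>r\<in>X. lagrange_weight X r * inverse (b - r) ^ j"
  shows "coeff \<phi> 0 * S 1 = 1"
    and "coeff \<phi> 1 * S 1 - coeff \<phi> 0 * S 2 = 0"
    and "coeff \<phi> 2 * S 1 - coeff \<phi> 1 * S 2 + coeff \<phi> 0 * S 3 = 0"
    and "coeff \<phi> 3 * S 1 - coeff \<phi> 2 * S 2 + coeff \<phi> 1 * S 3 - coeff \<phi> 0 * S 4 = 0"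
proof -
  define \<psi> where "\<psi> r = pcompose (root_poly (X - {r})) [:b, 1:]" for r
  have "1 = (\<Sum>r\<in>X. smult (lagrange_weight X r) (root_poly (X - {r})))"
    using lagrange_interpolation[OF assms(1), of 1] assms(1,2) by (simp add: card_gt_0_iff)
  then have "pcompose 1 [:b, 1:] = pcompose (\<Sum>r\<in>X. smult (lagrange_weight X r) (root_poly (X - {r}))) [:b, 1:]"
    by simp
  then have "1 = (\<Sum>r\<in>X. smult (lagrange_weight X r) (\<psi> r))"
    by (simp add: pcompose_1 pcompose_sum pcompose_smult \<psi>_def)
  then have one: "coeff 1 j = (\<Sum>r\<in>X. lagrange_weight X r * coeff (\<psi> r) j)" for j
    by (metis (no_types, lifting) coeff_smult coeff_sum sum.cong)
  have c: "coeff (\<psi> r) 0 = coeff \<phi> 0 * inverse (b - r) ^ 1 \<and>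
    coeff (\<psi> r) 1 = coeff \<phi> 1 * inverse (b - r) ^ 1 - coeff \<phi> 0 * inverse (b - r) ^ 2 \<and>
    coeff (\<psi> r) 2 = coeff \<phi> 2 * inverse (b - r) ^ 1 - coeff \<phi> 1 * inverse (b - r) ^ 2
      + coeff \<phi> 0 * inverse (b - r) ^ 3 \<and>
    coeff (\<psi> r) 3 = coeff \<phi> 3 * inverse (b - r) ^ 1 - coeff \<phi> 2 * inverse (b - r) ^ 2
      + coeff \<phi> 1 * inverse (b - r) ^ 3 - coeff \<phi> 0 * inverse (b - r) ^ 4"
    if r: "r \<in> X" for r
  proof -
    have t: "b - r \<noteq> 0" using r assms(3) by auto
    have \<phi>: "\<phi> = [:b - r, 1:] * \<psi> r"
      unfolding \<phi>_def \<psi>_def root_poly_remove[OF assms(1) r] pcompose_mult by (simp add: pcompose_pCons)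
    define t u where "t = b - r" and "u = inverse (b - r)"
    have tu: "t * u = 1" using t by (simp add: t_def u_def)
    have e: "coeff \<phi> 0 = t * coeff (\<psi> r) 0" "coeff \<phi> 1 = t * coeff (\<psi> r) 1 + coeff (\<psi> r) 0"
      "coeff \<phi> 2 = t * coeff (\<psi> r) 2 + coeff (\<psi> r) 1"
      "coeff \<phi> 3 = t * coeff (\<psi> r) 3 + coeff (\<psi> r) 2"
      unfolding \<phi> t_def by (simp_all add: eval_nat_numeral)
    have aux: "y = u * (x - z)" if "x = t * y + z" for x y z
      using that tu by (metis add_diff_cancel_right' mult.assoc mult.commute mult_1)
    have c0: "coeff (\<psi> r) 0 = coeff \<phi> 0 * u ^ 1" using aux[of "coeff \<phi> 0" "coeff (\<psi> r) 0" 0] e(1) by (simp add: mult.commute)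
    have c1: "coeff (\<psi> r) 1 = coeff \<phi> 1 * u ^ 1 - coeff \<phi> 0 * u ^ 2"
      using aux[OF e(2)] unfolding c0 by (simp add: algebra_simps power2_eq_square)
    have c2: "coeff (\<psi> r) 2 = coeff \<phi> 2 * u ^ 1 - coeff \<phi> 1 * u ^ 2 + coeff \<phi> 0 * u ^ 3"
      using aux[OF e(3)] unfolding c1 by (simp add: algebra_simps eval_nat_numeral)
    have c3: "coeff (\<psi> r) 3 = coeff \<phi> 3 * u ^ 1 - coeff \<phi> 2 * u ^ 2 + coeff \<phi> 1 * u ^ 3 - coeff \<phi> 0 * u ^ 4"
      using aux[OF e(4)] unfolding c2 by (simp add: algebra_simps eval_nat_numeral)
    show ?thesis using c0 c1 c2 c3 unfolding u_def by blast
  qed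
  have e: "coeff (1::'a poly) 1 = 0" "coeff (1::'a poly) 2 = 0" "coeff (1::'a poly) 3 = 0" "coeff (1::'a poly) 0 = 1"
    by simp_all
  have "coeff \<phi> 0 * S 1 = (\<Sum>r\<in>X. lagrange_weight X r * coeff (\<psi> r) 0)"
    unfolding S_def sum_distrib_left sum_subtractf[symmetric] sum.distrib[symmetric]
    by (rule sum.cong[OF refl]) (simp only: c, simp add: algebra_simps)
  then show "coeff \<phi> 0 * S 1 = 1" using one[of 0] e by simp
  have "coeff \<phi> 1 * S 1 - coeff \<phi> 0 * S 2 = (\<Sum>r\<in>X. lagrange_weight X r * coeff (\<psi> r) 1)"
    unfolding S_def sum_distrib_left sum_subtractf[symmetric] sum.distrib[symmetric]
    by (rule sum.cong[OF refl]) (simp only: c, simp add: algebra_simps)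
  then show "coeff \<phi> 1 * S 1 - coeff \<phi> 0 * S 2 = 0" using one[of 1] e by simp
  have "coeff \<phi> 2 * S 1 - coeff \<phi> 1 * S 2 + coeff \<phi> 0 * S 3 = (\<Sum>r\<in>X. lagrange_weight X r * coeff (\<psi> r) 2)"
    unfolding S_def sum_distrib_left sum_subtractf[symmetric] sum.distrib[symmetric]
    by (rule sum.cong[OF refl]) (simp only: c, simp add: algebra_simps)
  then show "coeff \<phi> 2 * S 1 - coeff \<phi> 1 * S 2 + coeff \<phi> 0 * S 3 = 0" using one[of 2] e by simp
  have "coeff \<phi> 3 * S 1 - coeff \<phi> 2 * S 2 + coeff \<phi> 1 * S 3 - coeff \<phi> 0 * S 4 = (\<Sum>r\<in>X. lagrange_weight X r * coeff (\<psi> r) 3)"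
    unfolding S_def sum_distrib_left sum_subtractf[symmetric] sum.distrib[symmetric]
    by (rule sum.cong[OF refl]) (simp only: c, simp add: algebra_simps)
  then show "coeff \<phi> 3 * S 1 - coeff \<phi> 2 * S 2 + coeff \<phi> 1 * S 3 - coeff \<phi> 0 * S 4 = 0" using one[of 3] e by simp
qed

text \<open>In the identity between \<open>stepanov_poly\<close> and a multiple of g^n, the Taylor
  coefficients of order n + 1, n + 2, n + 3 at b are compared with the one of order n, which removes
  the unknown multiple and \<open>\<eta>\<close>.\<close>

lemma taylor_relations:
  fixes X B :: "'a::field set"
  assumes fin: "finite X" "X \<noteq> {}" "finite B" and d: "card X * card B = d" "d \<ge> 4"
    and char: "\<forall>k. 0 < k \<and> k < card X + d \<longrightarrow> of_nat k \<noteq> (0::'a)"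
    and pow: "\<forall>b\<in>B. \<forall>r\<in>X. (b - r) ^ d = \<eta>" and disj: "X \<inter> B = {}" and b: "b \<in> B"
  defines "\<phi> \<equiv> pcompose (root_poly X) [:b, 1:]" and "\<gamma> \<equiv> pcompose (root_poly B) [:b, 1:]"
    and "N \<equiv> of_nat (card X)" and "D \<equiv> of_nat d"
  shows "\<exists>f1 f2 f3 r1 r2 r3. coeff \<phi> 0 \<noteq> 0 \<and> coeff \<gamma> 1 \<noteq> 0 \<and> coeff \<gamma> 0 = 0 \<and>
     coeff \<phi> 1 = coeff \<phi> 0 * f1 \<and> coeff \<phi> 2 = coeff \<phi> 0 * f2 \<and> coeff \<phi> 3 = coeff \<phi> 0 * f3 \<and>
     coeff \<gamma> 2 = coeff \<gamma> 1 * r1 \<and> coeff \<gamma> 3 = coeff \<gamma> 1 * r2 \<and> coeff \<gamma> 4 = coeff \<gamma> 1 * r3 \<and>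
     (N + 1) * N * r1 = (D - 1) * f1 \<and>
     (N + 1) * (N + 2) * (2 * N * r2 + N * (N - 1) * r1\<^sup>2) = 2 * (D - 1) * (D - 2) * (f1\<^sup>2 - f2) \<and>
     (N + 1) * (N + 2) * (N + 3) * (6 * N * r3 + 6 * N * (N - 1) * r1 * r2 + N * (N - 1) * (N - 2) * r1 ^ 3)
       = 6 * (D - 1) * (D - 2) * (D - 3) * (f1 ^ 3 - 2 * f1 * f2 + f3)"
proof -
  define n where "n = card X"
  have n: "n > 0" using fin by (simp add: n_def card_gt_0_iff)
  obtain C where C: "C \<noteq> 0" "stepanov_poly X d \<eta> = smult C (root_poly B ^ n)"
    using card_mult_card_le_of_const_power(2)[OF fin _ _ pow d(1)] char d(2) unfolding n_def by force
  have bX: "b \<notin> X" using disj b by auto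
  define G where "G = pcompose (root_poly (B - {b})) [:b, 1:]"
  have \<gamma>: "\<gamma> = pCons 0 G"
    unfolding \<gamma>_def G_def root_poly_remove[OF fin(3) b] pcompose_mult by (simp add: pcompose_pCons)
  define g1 where "g1 = coeff G 0"
  have g1: "g1 \<noteq> 0" using fin(3) unfolding g1_def G_def by (auto simp: poly_root_poly)
  define Q where "Q = smult (inverse g1) G"
  have Q0: "coeff Q 0 = 1" using g1 by (simp add: Q_def g1_def)
  have GQ: "G = smult g1 Q" using g1 by (simp add: Q_def)
  define \<beta> where "\<beta> j = (of_nat ((n - 1 + d) choose (n + j)) :: 'a)" for j
  define S where "S j = (\<Sum>r\<in>X. lagrange_weight X r * inverse (b - r) ^ j)" for j
  define K where "K = C * g1 ^ n"
  have K: "K \<noteq> 0" using C g1 by (simp add: K_def)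
  \<comment> \<open>Coefficient of order \<open>n + j\<close> on both sides. As
    \<open>\<gamma>\<close> is g1 x Q, its n-th power starts at order n. On the other side the
    exponent is d - (j + 1), which turns \<open>(b - r) ^ d = \<eta>\<close> into reciprocal powers;
    \<open>d \<ge> 4\<close> covers \<open>j \<le> 3\<close>.\<close>
  have key: "K * coeff (Q ^ n) j = \<eta> * \<beta> j * S (Suc j)" if j: "j \<le> 3" for j
  proof -
    have "pcompose (stepanov_poly X d \<eta>) [:b, 1:] = smult C (\<gamma> ^ n)"
      unfolding C(2) \<gamma>_def by (simp add: pcompose_smult pcompose_power)
    also have "\<gamma> ^ n = monom 1 n * smult (g1 ^ n) (Q ^ n)"
    proof -
      have "\<gamma> = monom 1 1 * smult g1 Q" unfolding \<gamma> GQ by (simp add: monom_altdef)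
      then show ?thesis by (simp only: power_mult_distrib smult_power monom_power) simp
    qed
    finally have "coeff (pcompose (stepanov_poly X d \<eta>) [:b, 1:]) (n + j) = K * coeff (Q ^ n) j"
      by (simp add: coeff_monom_mult K_def)
    moreover have "coeff (pcompose (stepanov_poly X d \<eta>) [:b, 1:]) (n + j)
        = \<beta> j * (\<Sum>r\<in>X. lagrange_weight X r * (b - r) ^ (n - 1 + d - (n + j)))"
      using coeff_shift_stepanov_poly[of "n + j" X d \<eta> b] j d(2) n by (simp add: n_def \<beta>_def)
    moreover have "(\<Sum>r\<in>X. lagrange_weight X r * (b - r) ^ (n - 1 + d - (n + j))) = \<eta> * S (Suc j)"
      unfolding S_def sum_distrib_left
    proof (rule sum.cong[OF refl])
      fix r assume r: "r \<in> X"
      then have t: "b - r \<noteq> 0" using bX by auto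
      have "d = (n - 1 + d - (n + j)) + Suc j" using j d(2) n by simp
      then have "(b - r) ^ (n - 1 + d - (n + j)) * (b - r) ^ Suc j = \<eta>"
        using pow b r by (metis power_add)
      then have "(b - r) ^ (n - 1 + d - (n + j)) = \<eta> * inverse (b - r) ^ Suc j"
        using t by (simp add: field_simps)
      then show "lagrange_weight X r * (b - r) ^ (n - 1 + d - (n + j))
        = \<eta> * (lagrange_weight X r * inverse (b - r) ^ Suc j)" by simp
    qed
    ultimately show ?thesis by (simp add: mult_ac)
  qed
  have \<beta>: "\<beta> (Suc j) * (N + of_nat j + 1) = \<beta> j * (D - of_nat j - 1)" if j: "j \<le> 3" for j
  proof -
    have "Suc (n + j) * ((n - 1 + d) choose Suc (n + j)) = (n - 1 + d - (n + j)) * ((n - 1 + d) choose (n + j))"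
      by (metis binomial_absorption binomial_absorb_comp mult.commute)
    then have "of_nat (Suc (n + j)) * \<beta> (Suc j) = of_nat (n - 1 + d - (n + j)) * \<beta> j"
      unfolding \<beta>_def by (metis add_Suc_right of_nat_mult)
    moreover have "n - 1 + d - (n + j) = d - Suc j" using n by simp
    ultimately show ?thesis using j d(2) by (simp add: N_def D_def n_def algebra_simps of_nat_diff)
  qed
  note rs = reciprocal_power_sums[OF fin(1,2) bX, folded \<phi>_def S_def]
  define p0 where "p0 = coeff \<phi> 0"
  have p0: "p0 \<noteq> 0" using rs(1) unfolding p0_def by auto
  define f1 f2 f3 where "f1 = coeff \<phi> 1 / p0" and "f2 = coeff \<phi> 2 / p0" and "f3 = coeff \<phi> 3 / p0"
  define r1 r2 r3 where "r1 = coeff Q 1" and "r2 = coeff Q 2" and "r3 = coeff Q 3"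
  have fs: "coeff \<phi> 1 = p0 * f1" "coeff \<phi> 2 = p0 * f2" "coeff \<phi> 3 = p0 * f3"
    using p0 by (simp_all add: f1_def f2_def f3_def)
  have S2: "S 2 = f1 * S 1"
    using rs(2) p0 unfolding fs p0_def[symmetric] by (simp add: algebra_simps)
  have "p0 * (f2 * S 1 - f1 * S 2 + S 3) = 0"
    using rs(3) unfolding fs p0_def[symmetric] by (simp add: algebra_simps)
  then have "f2 * S 1 - f1 * S 2 + S 3 = 0" using p0 by simp
  then have S3: "S 3 = (f1\<^sup>2 - f2) * S 1" unfolding S2 by Groebner_Basis.algebra
  have "p0 * (f3 * S 1 - f2 * S 2 + f1 * S 3 - S 4) = 0"
    using rs(4) unfolding fs p0_def[symmetric] by (simp add: algebra_simps)
  then have "f3 * S 1 - f2 * S 2 + f1 * S 3 - S 4 = 0" using p0 by simp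
  then have S4: "S 4 = (f1 ^ 3 - 2 * f1 * f2 + f3) * S 1" unfolding S2 S3 by Groebner_Basis.algebra
  note q = coeff_power_low[OF Q0, of n, folded r1_def r2_def r3_def]
  have Nn: "of_nat n = N" by (simp add: N_def n_def)
  have k0: "K = \<eta> * \<beta> 0 * S 1" using key[of 0] q(1) by simp
  have k1: "K * (N * r1) = \<eta> * \<beta> 1 * (f1 * S 1)"
    using key[of 1] q(2) S2 Nn by (simp add: numeral_2_eq_2)
  have k2: "K * (2 * N * r2 + N * (N - 1) * r1\<^sup>2) = 2 * (\<eta> * \<beta> 2 * ((f1\<^sup>2 - f2) * S 1))"
  proof -
    have "K * (2 * N * r2 + N * (N - 1) * r1\<^sup>2) = 2 * (K * coeff (Q ^ n) 2)"
      using q(3) Nn by (metis mult.left_commute)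
    also have "\<dots> = 2 * (\<eta> * \<beta> 2 * S 3)" using key[of 2] by (simp add: eval_nat_numeral)
    finally show ?thesis unfolding S3 .
  qed
  have k3: "K * (6 * N * r3 + 6 * N * (N - 1) * r1 * r2 + N * (N - 1) * (N - 2) * r1 ^ 3)
      = 6 * (\<eta> * \<beta> 3 * ((f1 ^ 3 - 2 * f1 * f2 + f3) * S 1))"
  proof -
    have "K * (6 * N * r3 + 6 * N * (N - 1) * r1 * r2 + N * (N - 1) * (N - 2) * r1 ^ 3) = 6 * (K * coeff (Q ^ n) 3)"
      using q(4) Nn by (metis mult.left_commute)
    also have "\<dots> = 6 * (\<eta> * \<beta> 3 * S 4)" using key[of 3] by (simp add: eval_nat_numeral)
    finally show ?thesis unfolding S4 .
  qed
  have b1: "\<beta> 1 * (N + 1) = \<beta> 0 * (D - 1)" using \<beta>[of 0] by simp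
  have b2: "\<beta> 2 * (N + 2) = \<beta> 1 * (D - 2)" using \<beta>[of 1] by (simp add: numeral_2_eq_2 algebra_simps)
  have b3: "\<beta> 3 * (N + 3) = \<beta> 2 * (D - 3)" using \<beta>[of 2] by (simp add: numeral_3_eq_3 numeral_2_eq_2 algebra_simps)
  \<comment> \<open>Inserting \<open>k0\<close>, the equation of order n, and the ratios
    \<open>b1\<close> to \<open>b3\<close> of consecutive binomial coefficients leaves the nonzero
    common factor \<open>K\<close>.\<close>
  have "K * ((N + 1) * N * r1) = K * ((D - 1) * f1)"
    using k1 b1 k0 by Groebner_Basis.algebra
  then have R1: "(N + 1) * N * r1 = (D - 1) * f1" using K by simp
  have "K * ((N + 1) * (N + 2) * (2 * N * r2 + N * (N - 1) * r1\<^sup>2)) = K * (2 * (D - 1) * (D - 2) * (f1\<^sup>2 - f2))"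
    using k2 b1 b2 k0 by Groebner_Basis.algebra
  then have R2: "(N + 1) * (N + 2) * (2 * N * r2 + N * (N - 1) * r1\<^sup>2) = 2 * (D - 1) * (D - 2) * (f1\<^sup>2 - f2)"
    using K by (metis mult_left_cancel)
  define L where "L = 6 * N * r3 + 6 * N * (N - 1) * r1 * r2 + N * (N - 1) * (N - 2) * r1 ^ 3"
  define M where "M = f1 ^ 3 - 2 * f1 * f2 + f3"
  have "K * L = 6 * (\<eta> * \<beta> 3 * (M * S 1))" using k3 by (simp add: L_def M_def)
  then have "K * ((N + 1) * (N + 2) * (N + 3) * L) = K * (6 * (D - 1) * (D - 2) * (D - 3) * M)"
    using b1 b2 b3 k0 by Groebner_Basis.algebra
  then have R3: "(N + 1) * (N + 2) * (N + 3) * L = 6 * (D - 1) * (D - 2) * (D - 3) * M"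
    using K by (metis mult_left_cancel)
  have gs: "coeff \<gamma> 0 = 0" "coeff \<gamma> 1 = g1" "coeff \<gamma> 2 = g1 * r1" "coeff \<gamma> 3 = g1 * r2" "coeff \<gamma> 4 = g1 * r3"
    unfolding \<gamma> GQ r1_def r2_def r3_def using Q0 by (simp_all add: eval_nat_numeral)
  show ?thesis
    by (rule exI[of _ f1], rule exI[of _ f2], rule exI[of _ f3], rule exI[of _ r1], rule exI[of _ r2],
        rule exI[of _ r3]) (use gs fs p0 g1 R1 R2 R3 in \<open>simp add: p0_def[symmetric] L_def M_def\<close>)
qed

section \<open>Elimination\<close>

text \<open>The unknowns \<open>f1, f2, f3\<close> stand for the Taylor coefficients of \<open>f/f(b)\<close> at a root \<open>b\<close> of \<open>g\<close>, and
  \<open>r1, r2, r3\<close> for those of \<open>g/(g'(b) (x - b))\<close>.\<close>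

lemma second_order_solution:
  fixes N M r1 r2 f1 f2 :: "'a::field"
  assumes NM: "2 * N * M = - 1"
    and nz: "(2::'a) \<noteq> 0" "(3::'a) \<noteq> 0" "(5::'a) \<noteq> 0" "N \<noteq> 0" "N + 1 \<noteq> 0" "N - 2 \<noteq> 0"
      "3 * N + 1 \<noteq> 0" "4 * N - 1 \<noteq> 0"
    and e1: "2 * N * (N + 1) * r1 = - 3 * f1"
    and e2: "2 * (N + 1) * (N + 2) * (2 * N * r2 + N * (N - 1) * r1\<^sup>2) = 15 * (f1\<^sup>2 - f2)"
    and w1: "6 * (N * (N + 1)) * r2 + 2 * (N * (N + 1) + 3) * f1 * r1 + 2 * (M * (M + 1) + 3) * f2 = 0"
  obtains s k where "r1 = 3 * s" "f1 = - 2 * N * (N + 1) * s" "s\<^sup>2 = (3 * N + 1) * (4 * N - 1) * k"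
    "2 * r2 = 3 * (4 * N + 1) * (6 * N\<^sup>2 + 13 * N - 3) * k"
    "f2 = 6 * N ^ 3 * (N\<^sup>2 - 1) * (4 * N + 3) * k"
proof -
  \<comment> \<open>Once M is eliminated, \<open>e2\<close> and \<open>w1\<close> are linear in
    \<open>r2\<close> and \<open>f2\<close> with determinant 4 N (N + 1) (N - 2) (3 N + 1) (4 N -
    1). Putting the last two factors into \<open>k\<close> makes the solution polynomial in
    \<open>N\<close>.\<close>
  define s k where "s = r1 / 3" and "k = s\<^sup>2 / ((3 * N + 1) * (4 * N - 1))"
  have r1: "r1 = 3 * s" using nz by (simp add: s_def)
  have "3 * f1 = 3 * (- 2 * N * (N + 1) * s)" using e1 unfolding r1 by Groebner_Basis.algebra
  then have f1: "f1 = - 2 * N * (N + 1) * s" using nz(2) by (metis mult_left_cancel)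
  have s2: "s\<^sup>2 = (3 * N + 1) * (4 * N - 1) * k" using nz by (simp add: k_def)
  \<comment> \<open>This is \<open>w1\<close> times 2 N^2, with 4 N^2 M (M + 1) = 1 - 2 N.\<close>
  have w1': "12 * N ^ 3 * (N + 1) * r2 + 4 * N\<^sup>2 * (N\<^sup>2 + N + 3) * f1 * r1 + (12 * N\<^sup>2 - 2 * N + 1) * f2 = 0"
    using w1 NM by Groebner_Basis.algebra
  define D where "D = (3 * N + 1) * (4 * N - 1)"
  have "(4::'a) = 2 * 2" by simp
  then have four: "(4::'a) \<noteq> 0" using nz(1) by (simp only: mult_eq_0_iff) blast
  have "(4 * N * (N + 1) * (N - 2) * D) * (2 * r2)
      = (4 * N * (N + 1) * (N - 2) * D) * (3 * (4 * N + 1) * (6 * N\<^sup>2 + 13 * N - 3) * k)"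
    using e2 w1' s2 unfolding r1 f1 D_def by Groebner_Basis.algebra
  then have r2: "2 * r2 = 3 * (4 * N + 1) * (6 * N\<^sup>2 + 13 * N - 3) * k"
    using nz four unfolding D_def by (subst (asm) mult_cancel_left) auto
  have "15 * f2 = 15 * (6 * N ^ 3 * (N\<^sup>2 - 1) * (4 * N + 3) * k)"
    using e2 r2 s2 unfolding r1 f1 by Groebner_Basis.algebra
  moreover have "(15::'a) = 3 * 5" by simp
  then have "(15::'a) \<noteq> 0" using nz(2,3) by (simp only: mult_eq_0_iff) blast
  ultimately have f2: "f2 = 6 * N ^ 3 * (N\<^sup>2 - 1) * (4 * N + 3) * k" by (metis mult_left_cancel)
  from that[OF r1 f1 s2 r2 f2] show ?thesis .
qed

text \<open>The third order identity has coefficients \<open>bil1 N M, bil2 N M, - bil2 M N, - bil1 M N\<close>.  Together with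
  the coefficients of the derivative of the second order identity they span the solutions of the two linear
  conditions imposed at the roots of \<open>g\<close> and of \<open>f\<close>; being antisymmetric, they satisfy both conditions as soon
  as they satisfy one.\<close>

definition bil1 :: "'a::field \<Rightarrow> 'a \<Rightarrow> 'a" where
  "bil1 N M = N * (N + 1) * (28 * N + 11) * (4 * M + 1)"

definition bil2 :: "'a::field \<Rightarrow> 'a \<Rightarrow> 'a" where
  "bil2 N M = (33 + 17 * N - 11 * N\<^sup>2) * (4 * N + 1) * (4 * M + 1)"

text \<open>The conclusion is the condition for the third order identity to hold at a root of g. In
  terms of \<open>s\<close> and \<open>k\<close> every term is a multiple of \<open>k\<close>, and
  after removal of M a polynomial identity in \<open>N\<close> remains.\<close>

lemma third_order_local_relation:
  fixes N M r1 r2 f1 f2 s k :: "'a::field"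
  assumes NM: "2 * N * M = - 1"
    and r1: "r1 = 3 * s" and f1: "f1 = - 2 * N * (N + 1) * s" and s2: "s\<^sup>2 = (3 * N + 1) * (4 * N - 1) * k"
    and r2: "2 * r2 = 3 * (4 * N + 1) * (6 * N\<^sup>2 + 13 * N - 3) * k"
    and f2: "f2 = 6 * N ^ 3 * (N\<^sup>2 - 1) * (4 * N + 3) * k"
  shows "6 * bil1 N M * r2 + 2 * bil2 N M * f1 * r1 - 2 * bil2 M N * f2 = 0"
proof -
  have b: "4 * N\<^sup>2 * (33 + 17 * M - 11 * M\<^sup>2) = 132 * N\<^sup>2 - 34 * N - 11" using NM by Groebner_Basis.algebra
  define u where "u = 33 + 17 * M - 11 * M\<^sup>2"
  have "6 * (N * (N + 1) * (28 * N + 11)) * r2 + 2 * ((33 + 17 * N - 11 * N\<^sup>2) * (4 * N + 1)) * f1 * r1 - 2 * (u * (4 * N + 1)) * f2 = 0"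
    (is "?L = 0")
  proof -
    have fr: "f1 * r1 = - 6 * N * (N + 1) * ((3 * N + 1) * (4 * N - 1) * k)"
      unfolding s2[symmetric] r1 f1 by (simp add: power2_eq_square)
    have "?L = 3 * (N * (N + 1) * (28 * N + 11)) * (2 * r2) + 2 * ((33 + 17 * N - 11 * N\<^sup>2) * (4 * N + 1)) * (f1 * r1)
        - 3 * (4 * N\<^sup>2 * u) * (4 * N + 1) * N * (N\<^sup>2 - 1) * (4 * N + 3) * k"
      unfolding f2 by Groebner_Basis.algebra
    also have "\<dots> = 0" unfolding r2 fr b[folded u_def] by Groebner_Basis.algebra
    finally show ?thesis .
  qed
  moreover have "6 * bil1 N M * r2 + 2 * bil2 N M * f1 * r1 - 2 * bil2 M N * f2 = (4 * M + 1) * ?L"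
    unfolding bil1_def bil2_def u_def by Groebner_Basis.algebra
  ultimately show ?thesis by (simp only: mult_zero_right)
qed

text \<open>\<open>w2\<close>, \<open>x2\<close> and \<open>e3\<close> are linear equations in
  \<open>r3\<close>, \<open>f3\<close> and s k. Their determinant is nonzero under the hypotheses,
  so s k = 0, and then s^3, a multiple of s k, is zero.\<close>

lemma third_order_elimination:
  fixes N M r1 r2 r3 f1 f2 f3 s k :: "'a::field"
  assumes NM: "2 * N * M = - 1"
    and nz: "(2::'a) \<noteq> 0" "(3::'a) \<noteq> 0" "N \<noteq> 0" "N + 1 \<noteq> 0" "N - 1 \<noteq> 0" "N - 2 \<noteq> 0" "N - 3 \<noteq> 0"
      "4 * N + 1 \<noteq> 0" "2 * N - 1 \<noteq> 0"
    and r1: "r1 = 3 * s" and f1: "f1 = - 2 * N * (N + 1) * s" and s2: "s\<^sup>2 = (3 * N + 1) * (4 * N - 1) * k"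
    and r2: "2 * r2 = 3 * (4 * N + 1) * (6 * N\<^sup>2 + 13 * N - 3) * k"
    and f2: "f2 = 6 * N ^ 3 * (N\<^sup>2 - 1) * (4 * N + 3) * k"
    and e3: "4 * (N + 1) * (N + 2) * (N + 3) * (6 * N * r3 + 6 * N * (N - 1) * r1 * r2 + N * (N - 1) * (N - 2) * r1 ^ 3)
       = - 315 * (f1 ^ 3 - 2 * f1 * f2 + f3)"
    and w2: "24 * (N * (N + 1)) * r3 + 6 * (2 * (N * (N + 1)) + 3) * f1 * r2
       + 4 * (N * (N + 1) + M * (M + 1) + 6) * f2 * r1 + 6 * (2 * (M * (M + 1)) + 3) * f3 = 0"
    and x2: "24 * bil1 N M * r3 + 6 * (bil1 N M + bil2 N M) * f1 * r2
       + 4 * (bil2 N M - bil2 M N) * f2 * r1 - 6 * (bil2 M N + bil1 M N) * f3 = 0"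
    and quartic: "4 * N ^ 4 + 2 * N ^ 3 - 10 * N\<^sup>2 - 4 * N - 1 \<noteq> 0"
  shows "r1 = 0"
proof -
  \<comment> \<open>As \<open>s\<^sup>2\<close> is a multiple of \<open>k\<close>, all cubic
    products of known data are multiples of \<open>z\<close> (\<open>A1\<close> to
    \<open>A6\<close>), which becomes the third unknown. \<open>R\<close> absorbs the factor that
    \<open>r3\<close> carries in all three equations.\<close>
  define z R where "z = s * k" and "R = 8 * N * (N + 1) * r3"
  have "(4::'a) = 2 * 2" by simp
  then have four: "(4::'a) \<noteq> 0" using nz(1) by (simp only: mult_eq_0_iff) blast
  have canc: "e = 0" if "c * e = 0" "c \<noteq> 0" for c e :: 'a using that by simp
  have m1: "3 * c * (f1 * (2 * r2)) = 6 * c * f1 * r2" and m2: "4 * c * (f2 * r1) = 4 * c * f2 * r1"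
    for c by (Groebner_Basis.algebra, Groebner_Basis.algebra)
  have m3: "3 * N * (N - 1) * (r1 * (2 * r2)) = 6 * N * (N - 1) * r1 * r2" and m4: "2 * (f1 * f2) = 2 * f1 * f2"
    by (Groebner_Basis.algebra, Groebner_Basis.algebra)
  have A1: "f1 * (2 * r2) = - 6 * N * (N + 1) * (4 * N + 1) * (6 * N\<^sup>2 + 13 * N - 3) * z"
    unfolding r2 f1 z_def by Groebner_Basis.algebra
  have A2: "f2 * r1 = 18 * N ^ 3 * (N\<^sup>2 - 1) * (4 * N + 3) * z"
    unfolding f2 r1 z_def by Groebner_Basis.algebra
  have A3: "r1 * (2 * r2) = 9 * (4 * N + 1) * (6 * N\<^sup>2 + 13 * N - 3) * z"
    unfolding r2 r1 z_def by Groebner_Basis.algebra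
  have s3: "s ^ 3 = (3 * N + 1) * (4 * N - 1) * z"
    using s2 unfolding z_def by Groebner_Basis.algebra
  have A4: "r1 ^ 3 = 27 * (3 * N + 1) * (4 * N - 1) * z"
    using s3 unfolding r1 by Groebner_Basis.algebra
  have A5: "f1 ^ 3 = - 8 * N ^ 3 * (N + 1) ^ 3 * (3 * N + 1) * (4 * N - 1) * z"
    using s3 unfolding f1 by Groebner_Basis.algebra
  have A6: "f1 * f2 = - 12 * N ^ 4 * (N + 1) * (N\<^sup>2 - 1) * (4 * N + 3) * z"
    unfolding f1 f2 z_def by Groebner_Basis.algebra
  define w x v where "w = 8 * N ^ 6 - 18 * N ^ 5 - 42 * N ^ 4 - 117 * N ^ 3 - 118 * N\<^sup>2 + 4 * N + 3"
    and "x = - 88 * N ^ 6 + 206 * N ^ 5 - 152 * N ^ 4 - 1162 * N ^ 3 - 990 * N\<^sup>2 - 31 * N + 33"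
    and "v = 108 * N ^ 5 - 691 * N ^ 4 - 537 * N ^ 3 - 593 * N\<^sup>2 + 15 * N + 18"
  have "3 * (N\<^sup>2 * R + (6 * N\<^sup>2 - 2 * N + 1) * f3 + 12 * N ^ 3 * (N + 1) * w * z) = 0"
  proof -
    have "24 * (N * (N + 1)) * r3 + 3 * (2 * (N * (N + 1)) + 3) * (f1 * (2 * r2))
       + 4 * (N * (N + 1) + M * (M + 1) + 6) * (f2 * r1) + 6 * (2 * (M * (M + 1)) + 3) * f3 = 0"
      using w2 by (simp only: m1 m2)
    then have "4 * N\<^sup>2 * (24 * (N * (N + 1)) * r3 + 3 * (2 * (N * (N + 1)) + 3) * (f1 * (2 * r2)))
       + 4 * (4 * N\<^sup>2 * (N * (N + 1) + 6) + (4 * N\<^sup>2 * (M * (M + 1)))) * (f2 * r1)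
       + 6 * (2 * (4 * N\<^sup>2 * (M * (M + 1))) + 12 * N\<^sup>2) * f3 = 0"
      by Groebner_Basis.algebra
    moreover have m: "4 * N\<^sup>2 * (M * (M + 1)) = 1 - 2 * N" using NM by Groebner_Basis.algebra
    have "4 * N\<^sup>2 * (24 * (N * (N + 1)) * r3 + 3 * (2 * (N * (N + 1)) + 3) * (f1 * (2 * r2)))
       + 4 * (4 * N\<^sup>2 * (N * (N + 1) + 6) + (4 * N\<^sup>2 * (M * (M + 1)))) * (f2 * r1)
       + 6 * (2 * (4 * N\<^sup>2 * (M * (M + 1))) + 12 * N\<^sup>2) * f3
      = 4 * (3 * (N\<^sup>2 * R + (6 * N\<^sup>2 - 2 * N + 1) * f3 + 12 * N ^ 3 * (N + 1) * w * z))"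
      unfolding A1 A2 R_def w_def m by Groebner_Basis.algebra
    ultimately show ?thesis by (metis canc four)
  qed
  then have E1: "N\<^sup>2 * R + (6 * N\<^sup>2 - 2 * N + 1) * f3 + 12 * N ^ 3 * (N + 1) * w * z = 0"
    by (rule canc) (rule nz(2))
  have "3 * ((N + 2) * (N + 3) * R + 105 * f3 + 12 * N * (N + 1)\<^sup>2 * v * z) = 0"
  proof -
    have "4 * (N + 1) * (N + 2) * (N + 3) * (6 * N * r3 + 3 * N * (N - 1) * (r1 * (2 * r2)) + N * (N - 1) * (N - 2) * r1 ^ 3)
       = - 315 * (f1 ^ 3 - 2 * (f1 * f2) + f3)"
      using e3 by (simp only: m3 m4)
    then have "4 * (N + 1) * (N + 2) * (N + 3) * (6 * N * r3 + 3 * N * (N - 1) * (r1 * (2 * r2)) + N * (N - 1) * (N - 2) * r1 ^ 3)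
       + 315 * (f1 ^ 3 - 2 * (f1 * f2) + f3) = 0" by (simp only: mult_minus_left add.left_inverse)
    moreover have "4 * (N + 1) * (N + 2) * (N + 3) * (6 * N * r3 + 3 * N * (N - 1) * (r1 * (2 * r2)) + N * (N - 1) * (N - 2) * r1 ^ 3)
       + 315 * (f1 ^ 3 - 2 * (f1 * f2) + f3) = 3 * ((N + 2) * (N + 3) * R + 105 * f3 + 12 * N * (N + 1)\<^sup>2 * v * z)"
      unfolding A3 A4 A5 A6 R_def v_def by Groebner_Basis.algebra
    ultimately show ?thesis by (simp only:)
  qed
  then have E2: "(N + 2) * (N + 3) * R + 105 * f3 + 12 * N * (N + 1)\<^sup>2 * v * z = 0"
    by (rule canc) (rule nz(2))
  have "3 * (N\<^sup>2 * (N - 2) * (28 * N + 11) * R + 2 * (4 * N + 1) * (- 33 * N ^ 3 + 80 * N\<^sup>2 - 24 * N - 2) * f3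
     + 12 * N ^ 3 * (N + 1) * (N - 2) * (4 * N + 1) * x * z) = 0"
  proof -
    \<comment> \<open>Powers of N turn the factors in M into polynomials in N; for instance N (4 M +
      1) = N - 2.\<close>
    have b1: "N * bil1 N M = N * (N + 1) * (28 * N + 11) * (N - 2)"
      unfolding bil1_def using NM by Groebner_Basis.algebra
    have b2: "N * bil2 N M = (33 + 17 * N - 11 * N\<^sup>2) * (4 * N + 1) * (N - 2)"
      unfolding bil2_def using NM by Groebner_Basis.algebra
    have b3: "4 * N ^ 3 * bil2 M N = (132 * N\<^sup>2 - 34 * N - 11) * (4 * N + 1) * (N - 2)"
      unfolding bil2_def using NM by Groebner_Basis.algebra
    have b4: "4 * N ^ 3 * bil1 M N = - (2 * N - 1) * (11 * N - 14) * (4 * N + 1)"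
      unfolding bil1_def using NM by Groebner_Basis.algebra
    have x2': "24 * bil1 N M * r3 + 3 * (bil1 N M + bil2 N M) * (f1 * (2 * r2))
       + 4 * (bil2 N M - bil2 M N) * (f2 * r1) - 6 * (bil2 M N + bil1 M N) * f3 = 0"
      using x2 by (simp only: m1 m2)
    have "(24 * (4 * N\<^sup>2 * (N * bil1 N M)) * r3 + 3 * (4 * N\<^sup>2 * (N * bil1 N M) + 4 * N\<^sup>2 * (N * bil2 N M)) * (f1 * (2 * r2))
       + 4 * (4 * N\<^sup>2 * (N * bil2 N M) - 4 * N ^ 3 * bil2 M N) * (f2 * r1) - 6 * (4 * N ^ 3 * bil2 M N + 4 * N ^ 3 * bil1 M N) * f3) = 0"
      using x2' by Groebner_Basis.algebra
    moreover have "24 * (4 * N\<^sup>2 * (N * bil1 N M)) * r3 + 3 * (4 * N\<^sup>2 * (N * bil1 N M) + 4 * N\<^sup>2 * (N * bil2 N M)) * (f1 * (2 * r2))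
       + 4 * (4 * N\<^sup>2 * (N * bil2 N M) - 4 * N ^ 3 * bil2 M N) * (f2 * r1) - 6 * (4 * N ^ 3 * bil2 M N + 4 * N ^ 3 * bil1 M N) * f3
      = 4 * (3 * (N\<^sup>2 * (N - 2) * (28 * N + 11) * R + 2 * (4 * N + 1) * (- 33 * N ^ 3 + 80 * N\<^sup>2 - 24 * N - 2) * f3
     + 12 * N ^ 3 * (N + 1) * (N - 2) * (4 * N + 1) * x * z))"
      unfolding b1 b2 b3 b4 A1 A2 R_def x_def by Groebner_Basis.algebra
    moreover note four
    ultimately show ?thesis by (metis canc)
  qed
  then have E3: "N\<^sup>2 * (N - 2) * (28 * N + 11) * R + 2 * (4 * N + 1) * (- 33 * N ^ 3 + 80 * N\<^sup>2 - 24 * N - 2) * f3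
     + 12 * N ^ 3 * (N + 1) * (N - 2) * (4 * N + 1) * x * z = 0"
    by (rule canc) (rule nz(2))
  have cramer: "(a3 * (b1 * c2 - c1 * b2) - b3 * (a1 * c2 - c1 * a2) + c3 * (a1 * b2 - b1 * a2)) * z = 0"
    if "a1 * R + b1 * f3 + c1 * z = 0" "a2 * R + b2 * f3 + c2 * z = 0" "a3 * R + b3 * f3 + c3 * z = 0"
    for a1 a2 a3 b1 b2 b3 c1 c2 c3
  proof -
    have "(a3 * (b1 * c2 - c1 * b2) - b3 * (a1 * c2 - c1 * a2) + c3 * (a1 * b2 - b1 * a2)) * z
      = (a2 * b3 - b2 * a3) * (a1 * R + b1 * f3 + c1 * z) - (a1 * b3 - b1 * a3) * (a2 * R + b2 * f3 + c2 * z)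
        + (a1 * b2 - b1 * a2) * (a3 * R + b3 * f3 + c3 * z)"
      by Groebner_Basis.algebra
    then show ?thesis unfolding that by simp
  qed
  define det where "det = (N + 2) * (N + 3) * ((6 * N\<^sup>2 - 2 * N + 1) * (12 * N ^ 3 * (N + 1) * (N - 2) * (4 * N + 1) * x)
        - 12 * N ^ 3 * (N + 1) * w * (2 * (4 * N + 1) * (- 33 * N ^ 3 + 80 * N\<^sup>2 - 24 * N - 2)))
      - 105 * (N\<^sup>2 * (12 * N ^ 3 * (N + 1) * (N - 2) * (4 * N + 1) * x)
        - 12 * N ^ 3 * (N + 1) * w * (N\<^sup>2 * (N - 2) * (28 * N + 11)))
      + 12 * N * (N + 1)\<^sup>2 * v * (N\<^sup>2 * (2 * (4 * N + 1) * (- 33 * N ^ 3 + 80 * N\<^sup>2 - 24 * N - 2))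
        - (6 * N\<^sup>2 - 2 * N + 1) * (N\<^sup>2 * (N - 2) * (28 * N + 11)))"
  \<comment> \<open>Apart from the quartic every factor is nonzero by \<open>nz\<close>. The factor
    \<open>N - 3\<close> is the reason why sets of three elements are treated separately.\<close>
  have "det = - 432 * (N + 1) * N ^ 4 * (N - 1) * (N - 2) * (N - 3) * (2 * N - 1) * (4 * N + 1)
    * (4 * N ^ 4 + 2 * N ^ 3 - 10 * N\<^sup>2 - 4 * N - 1)"
    unfolding det_def w_def x_def v_def by Groebner_Basis.algebra
  moreover have "det * z = 0"
    using cramer[OF E1 E3 E2] unfolding det_def .
  moreover have "(- 432::'a) = - (2 * 2 * 2 * 2 * 3 * 3 * 3)" by simp
  then have "(- 432::'a) \<noteq> 0" using nz(1,2) by (simp only: neg_equal_0_iff_equal mult_eq_0_iff) blast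
  ultimately have "z = 0"
    using nz quartic by (simp only: mult_eq_0_iff power_eq_0_iff) blast
  then have "s = 0" using s3 by simp
  then show ?thesis using r1 by simp
qed

section \<open>Bilinear differential identities\<close>

text \<open>The factors 2, 6, 24 turn normalised Taylor coefficients into derivatives. The last
  three equations are those of \<open>taylor_relations\<close> with D = -1/2, which is (p - 1)/2
  modulo p.\<close>

definition local_data ::
  "'a::field poly \<Rightarrow> 'a poly \<Rightarrow> 'a \<Rightarrow> 'a \<Rightarrow> 'a \<Rightarrow> 'a \<Rightarrow> 'a \<Rightarrow> 'a \<Rightarrow> 'a \<Rightarrow> 'a \<Rightarrow> bool" where
  "local_data f g N b f1 f2 f3 r1 r2 r3 \<longleftrightarrow>
    poly f b \<noteq> 0 \<and> poly g b = 0 \<and> poly (pderiv g) b \<noteq> 0 \<and>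
    poly (pderiv f) b = poly f b * f1 \<and>
    poly (pderiv (pderiv f)) b = poly f b * (2 * f2) \<and>
    poly (pderiv (pderiv (pderiv f))) b = poly f b * (6 * f3) \<and>
    poly (pderiv (pderiv g)) b = poly (pderiv g) b * (2 * r1) \<and>
    poly (pderiv (pderiv (pderiv g))) b = poly (pderiv g) b * (6 * r2) \<and>
    poly (pderiv (pderiv (pderiv (pderiv g)))) b = poly (pderiv g) b * (24 * r3) \<and>
    2 * N * (N + 1) * r1 = - 3 * f1 \<and>
    2 * (N + 1) * (N + 2) * (2 * N * r2 + N * (N - 1) * r1\<^sup>2) = 15 * (f1\<^sup>2 - f2) \<and>
    4 * (N + 1) * (N + 2) * (N + 3) * (6 * N * r3 + 6 * N * (N - 1) * r1 * r2 + N * (N - 1) * (N - 2) * r1 ^ 3)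
      = - 315 * (f1 ^ 3 - 2 * f1 * f2 + f3)"

lemma local_data_exists:
  fixes X B :: "'a::field set"
  assumes "finite X" "X \<noteq> {}" "finite B" "card X * card B = d" "d \<ge> 4"
    and "\<forall>k. 0 < k \<and> k < card X + d \<longrightarrow> of_nat k \<noteq> (0::'a)"
    and "\<forall>b\<in>B. \<forall>r\<in>X. (b - r) ^ d = \<eta>" and "X \<inter> B = {}" and "b \<in> B"
    and D: "2 * of_nat d = (- 1 :: 'a)"
  shows "\<exists>f1 f2 f3 r1 r2 r3.
    local_data (root_poly X) (root_poly B) (of_nat (card X)) b f1 f2 f3 r1 r2 r3"
proof -
  define D' where "D' = (of_nat d :: 'a)"
  define N where "N = (of_nat (card X) :: 'a)"
  define \<phi> where "\<phi> = pcompose (root_poly X) [:b, 1:]"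
  define \<gamma> where "\<gamma> = pcompose (root_poly B) [:b, 1:]"
  have D: "2 * D' = - 1" using D by (simp add: D'_def)
  from taylor_relations[OF assms(1-9), folded \<phi>_def \<gamma>_def N_def D'_def]
  obtain f1 f2 f3 r1 r2 r3 where
    c: "coeff \<phi> 0 \<noteq> 0" "coeff \<gamma> 1 \<noteq> 0" "coeff \<gamma> 0 = 0"
     "coeff \<phi> 1 = coeff \<phi> 0 * f1" "coeff \<phi> 2 = coeff \<phi> 0 * f2" "coeff \<phi> 3 = coeff \<phi> 0 * f3"
     "coeff \<gamma> 2 = coeff \<gamma> 1 * r1" "coeff \<gamma> 3 = coeff \<gamma> 1 * r2" "coeff \<gamma> 4 = coeff \<gamma> 1 * r3"
    and e1: "(N + 1) * N * r1 = (D' - 1) * f1"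
    and e2: "(N + 1) * (N + 2) * (2 * N * r2 + N * (N - 1) * r1\<^sup>2) = 2 * (D' - 1) * (D' - 2) * (f1\<^sup>2 - f2)"
    and e3: "(N + 1) * (N + 2) * (N + 3) * (6 * N * r3 + 6 * N * (N - 1) * r1 * r2 + N * (N - 1) * (N - 2) * r1 ^ 3)
       = 6 * (D' - 1) * (D' - 2) * (D' - 3) * (f1 ^ 3 - 2 * f1 * f2 + f3)"
    by (elim exE conjE) (rule that; assumption)
  have E1: "2 * N * (N + 1) * r1 = - 3 * f1" using e1 D by Groebner_Basis.algebra
  define U where "U = 2 * N * r2 + N * (N - 1) * r1\<^sup>2"
  define V where "V = f1\<^sup>2 - f2"
  have E2: "2 * (N + 1) * (N + 2) * U = 15 * V"
    using e2[folded U_def V_def] D by Groebner_Basis.algebra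
  define U' where "U' = 6 * N * r3 + 6 * N * (N - 1) * r1 * r2 + N * (N - 1) * (N - 2) * r1 ^ 3"
  define V' where "V' = f1 ^ 3 - 2 * f1 * f2 + f3"
  have "4 * (6 * (D' - 1) * (D' - 2) * (D' - 3)) = - 315" using D by Groebner_Basis.algebra
  moreover have "4 * (N + 1) * (N + 2) * (N + 3) * U' = 4 * (6 * (D' - 1) * (D' - 2) * (D' - 3)) * V'"
    using arg_cong[OF e3[folded U'_def V'_def], of "\<lambda>x. 4 * x"] by (simp only: mult.assoc)
  ultimately have E3: "4 * (N + 1) * (N + 2) * (N + 3) * U' = - 315 * V'" by (simp only:)
  have "local_data (root_poly X) (root_poly B) N b f1 f2 f3 r1 r2 r3"
    unfolding local_data_def taylor_shift[of "root_poly X" b, folded \<phi>_def]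
      taylor_shift[of "root_poly B" b, folded \<gamma>_def]
    by (intro conjI E1 E2[unfolded U_def V_def] E3[unfolded U'_def V'_def] c(1-4)) (simp_all add: c(5-9))
  then show ?thesis unfolding N_def by blast
qed

lemma degree_pderiv_le: "degree (pderiv p) \<le> degree p - 1" for p :: "'a::field poly"
  by (rule degree_le) (auto simp: coeff_pderiv intro!: coeff_eq_0)

lemma poly_eq_0_of_many_roots:
  fixes p :: "'a::field poly"
  assumes "finite X" "finite B" "X \<inter> B = {}" "degree p < card X + card B"
    and "\<And>x. x \<in> X \<Longrightarrow> poly p x = 0" "\<And>x. x \<in> B \<Longrightarrow> poly p x = 0"
  shows "p = 0"
  by (rule poly_eqI_degree[of "X \<union> B"]) (use assms in \<open>auto simp: card_Un_disjoint\<close>)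

text \<open>Covers both the derivative of the second order identity and the new identity with
  coefficients \<open>bil1\<close> and \<open>bil2\<close>.\<close>

definition third_order_form :: "'a::field poly \<Rightarrow> 'a poly \<Rightarrow> 'a \<Rightarrow> 'a \<Rightarrow> 'a \<Rightarrow> 'a \<Rightarrow> 'a poly" where
  "third_order_form f g a b c e = smult a (f * pderiv (pderiv (pderiv g))) + smult b (pderiv f * pderiv (pderiv g))
     + smult c (pderiv (pderiv f) * pderiv g) + smult e (pderiv (pderiv (pderiv f)) * g)"

lemma poly_third_order_form:
  assumes "local_data f g N x f1 f2 f3 r1 r2 r3"
  shows "poly (third_order_form f g a b c e) x =
    poly f x * poly (pderiv g) x * (6 * a * r2 + 2 * b * f1 * r1 + 2 * c * f2)"
  using assms unfolding local_data_def third_order_form_def by (simp add: algebra_simps)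

text \<open>Unlike the value at a root of g, the derivative involves \<open>r3\<close> and
  \<open>f3\<close>; it supplies two of the three equations of the elimination.\<close>

lemma poly_pderiv_third_order_form:
  assumes "local_data f g N x f1 f2 f3 r1 r2 r3"
  shows "poly (pderiv (third_order_form f g a b c e)) x =
    poly f x * poly (pderiv g) x * (24 * a * r3 + 6 * (a + b) * f1 * r2 + 4 * (b + c) * f2 * r1 + 6 * (c + e) * f3)"
  using assms unfolding local_data_def third_order_form_def
  by (simp add: pderiv_add pderiv_smult pderiv_mult algebra_simps)

lemma third_order_form_swap: "third_order_form g f a b c e = third_order_form f g e c b a"
  unfolding third_order_form_def by (simp add: algebra_simps)

lemma third_order_form_minus:
  "third_order_form f g (- a) (- b) (- c) (- e) = - third_order_form f g a b c e"
  unfolding third_order_form_def by (simp add: algebra_simps)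

lemma degree_third_order_form:
  assumes "degree f > 0" "degree g > 0"
  shows "degree (third_order_form f g a b c e) < degree f + degree g"
proof -
  note l = degree_pderiv_le
  have 1: "degree (f * pderiv (pderiv (pderiv g))) \<le> degree f + degree g - 1"
    using degree_mult_le[of f "pderiv (pderiv (pderiv g))"] l[of g] l[of "pderiv g"] l[of "pderiv (pderiv g)"] assms
    by linarith
  have 2: "degree (pderiv f * pderiv (pderiv g)) \<le> degree f + degree g - 1"
    using degree_mult_le[of "pderiv f" "pderiv (pderiv g)"] l[of g] l[of "pderiv g"] l[of f] assms
    by linarith
  have 3: "degree (pderiv (pderiv f) * pderiv g) \<le> degree f + degree g - 1"
    using degree_mult_le[of "pderiv (pderiv f)" "pderiv g"] l[of g] l[of "pderiv f"] l[of f] assms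
    by linarith
  have 4: "degree (pderiv (pderiv (pderiv f)) * g) \<le> degree f + degree g - 1"
    using degree_mult_le[of "pderiv (pderiv (pderiv f))" g] l[of f] l[of "pderiv f"] l[of "pderiv (pderiv f)"] assms
    by linarith
  have "degree (third_order_form f g a b c e) \<le> degree f + degree g - 1"
    unfolding third_order_form_def
    by (intro degree_add_le order.trans[OF degree_smult_le] 1 2 3 4)
  then show ?thesis using assms by linarith
qed

text \<open>At a root of g the left side is a multiple of 2 N (N + 1) r1 + 3 f1, which is zero by
  the first local relation; the roots of f are symmetric. The degree is too small for that many
  zeros.\<close>

lemma second_order_identity:
  fixes X B :: "'a::field set"
  assumes fin: "finite X" "finite B" "X \<inter> B = {}" "card X > 0" "card B > 0"
    and B: "\<And>b. b \<in> B \<Longrightarrow> \<exists>f1 f2 f3 r1 r2 r3. local_data (root_poly X) (root_poly B) N b f1 f2 f3 r1 r2 r3"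
    and X: "\<And>r. r \<in> X \<Longrightarrow> \<exists>f1 f2 f3 r1 r2 r3. local_data (root_poly B) (root_poly X) M r f1 f2 f3 r1 r2 r3"
  defines "f \<equiv> root_poly X" and "g \<equiv> root_poly B"
  shows "smult (N * (N + 1)) (f * pderiv (pderiv g)) + smult 3 (pderiv f * pderiv g)
    + smult (M * (M + 1)) (pderiv (pderiv f) * g) = 0" (is "?W = 0")
proof (rule poly_eq_0_of_many_roots[OF fin(1-3)])
  have deg: "degree f = card X" "degree g = card B" by (simp_all add: f_def g_def)
  note l = degree_pderiv_le
  have 1: "degree (f * pderiv (pderiv g)) \<le> card X + card B - 1"
    using degree_mult_le[of f "pderiv (pderiv g)"] l[of g] l[of "pderiv g"] fin(4,5) deg by linarith
  have 2: "degree (pderiv f * pderiv g) \<le> card X + card B - 1"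
    using degree_mult_le[of "pderiv f" "pderiv g"] l[of g] l[of f] fin(4,5) deg by linarith
  have 3: "degree (pderiv (pderiv f) * g) \<le> card X + card B - 1"
    using degree_mult_le[of "pderiv (pderiv f)" g] l[of "pderiv f"] l[of f] fin(4,5) deg by linarith
  have "degree ?W \<le> card X + card B - 1"
    by (intro degree_add_le order.trans[OF degree_smult_le] 1 2 3)
  then show "degree ?W < card X + card B" using fin(4) by linarith
next
  fix b assume "b \<in> B"
  then obtain f1 f2 f3 r1 r2 r3 where "local_data f g N b f1 f2 f3 r1 r2 r3"
    using B unfolding f_def g_def by blast
  then have *: "poly g b = 0" "poly (pderiv (pderiv g)) b = poly (pderiv g) b * (2 * r1)"
    "poly (pderiv f) b = poly f b * f1" "2 * N * (N + 1) * r1 = - 3 * f1"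
    unfolding local_data_def by simp_all
  have "poly ?W b = poly f b * poly (pderiv g) b * (2 * N * (N + 1) * r1 + 3 * f1)"
    using *(1-3) by (simp add: algebra_simps)
  also have "\<dots> = 0" unfolding *(4) by simp
  finally show "poly ?W b = 0" .
next
  fix r assume "r \<in> X"
  then obtain f1 f2 f3 r1 r2 r3 where "local_data g f M r f1 f2 f3 r1 r2 r3"
    using X unfolding f_def g_def by blast
  then have *: "poly f r = 0" "poly (pderiv (pderiv f)) r = poly (pderiv f) r * (2 * r1)"
    "poly (pderiv g) r = poly g r * f1" "2 * M * (M + 1) * r1 = - 3 * f1"
    unfolding local_data_def by simp_all
  have "poly ?W r = poly g r * poly (pderiv f) r * (2 * M * (M + 1) * r1 + 3 * f1)"
    using *(1-3) by (simp add: algebra_simps)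
  also have "\<dots> = 0" unfolding *(4) by simp
  finally show "poly ?W r = 0" .
qed

text \<open>Collects the quantities that have to be invertible in
  \<open>second_order_solution\<close>.\<close>

definition good_size :: "'a::field \<Rightarrow> bool" where
  "good_size N \<longleftrightarrow> (2::'a) \<noteq> 0 \<and> (3::'a) \<noteq> 0 \<and> (5::'a) \<noteq> 0 \<and> N \<noteq> 0 \<and> N + 1 \<noteq> 0 \<and> N - 2 \<noteq> 0 \<and>
     3 * N + 1 \<noteq> 0 \<and> 4 * N - 1 \<noteq> 0"

text \<open>The coefficients in \<open>W\<close> are those of the derivative of the second order
  identity, which gives the second linear equation for \<open>r2\<close> and \<open>f2\<close>. The
  parametrisation by \<open>s\<close> and \<open>k\<close> is passed on for the elimination.\<close>

lemma third_order_vanishing: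
  fixes N :: "'a::field"
  assumes "2 * N * M = - 1" "good_size N" and ld: "local_data f g N b f1 f2 f3 r1 r2 r3"
    and W: "third_order_form f g (N * (N + 1)) (N * (N + 1) + 3) (M * (M + 1) + 3) (M * (M + 1)) = 0"
  obtains s k where "r1 = 3 * s" "f1 = - 2 * N * (N + 1) * s" "s\<^sup>2 = (3 * N + 1) * (4 * N - 1) * k"
    "2 * r2 = 3 * (4 * N + 1) * (6 * N\<^sup>2 + 13 * N - 3) * k"
    "f2 = 6 * N ^ 3 * (N\<^sup>2 - 1) * (4 * N + 3) * k"
    "poly (third_order_form f g (bil1 N M) (bil2 N M) (- bil2 M N) (- bil1 M N)) b = 0"
proof -
  have nz: "poly f b * poly (pderiv g) b \<noteq> 0" using ld unfolding local_data_def by simp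
  have "6 * (N * (N + 1)) * r2 + 2 * (N * (N + 1) + 3) * f1 * r1 + 2 * (M * (M + 1) + 3) * f2 = 0"
    using poly_third_order_form[OF ld, of "N * (N + 1)" "N * (N + 1) + 3" "M * (M + 1) + 3" "M * (M + 1)"] nz
    unfolding W by simp
  moreover have "2 * N * (N + 1) * r1 = - 3 * f1"
    "2 * (N + 1) * (N + 2) * (2 * N * r2 + N * (N - 1) * r1\<^sup>2) = 15 * (f1\<^sup>2 - f2)"
    using ld unfolding local_data_def by blast+
  moreover have "(2::'a) \<noteq> 0" "(3::'a) \<noteq> 0" "(5::'a) \<noteq> 0" "N \<noteq> 0" "N + 1 \<noteq> 0" "N - 2 \<noteq> 0"
    "3 * N + 1 \<noteq> 0" "4 * N - 1 \<noteq> 0" using assms(2) unfolding good_size_def by blast+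
  ultimately obtain s k where sk: "r1 = 3 * s" "f1 = - 2 * N * (N + 1) * s" "s\<^sup>2 = (3 * N + 1) * (4 * N - 1) * k"
    "2 * r2 = 3 * (4 * N + 1) * (6 * N\<^sup>2 + 13 * N - 3) * k"
    "f2 = 6 * N ^ 3 * (N\<^sup>2 - 1) * (4 * N + 3) * k"
    using second_order_solution[OF assms(1)] by blast
  have "6 * bil1 N M * r2 + 2 * bil2 N M * f1 * r1 - 2 * bil2 M N * f2 = 0"
    by (rule third_order_local_relation[OF assms(1) sk])
  then have "poly (third_order_form f g (bil1 N M) (bil2 N M) (- bil2 M N) (- bil1 M N)) b = 0"
    unfolding poly_third_order_form[OF ld] by simp
  with sk show ?thesis by (rule that)
qed

text \<open>If the quartic is nonzero, the elimination gives g'' = 0 at every root of g. The degree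
  of g'' is smaller than the number of roots, so g'' = 0, against its leading coefficient m (m -
  1).\<close>

lemma quartic_vanishes:
  fixes X B :: "'a::field set"
  assumes fin: "finite X" "finite B" "X \<inter> B = {}" "card X > 0" "card B \<ge> 2"
    and NM: "2 * N * M = - 1" and size: "good_size N" "good_size M"
    and N: "N - 1 \<noteq> 0" "N - 3 \<noteq> 0" "4 * N + 1 \<noteq> 0" "2 * N - 1 \<noteq> 0"
    and M: "M = of_nat (card B)" "M - 1 \<noteq> 0"
    and B: "\<And>b. b \<in> B \<Longrightarrow> \<exists>f1 f2 f3 r1 r2 r3. local_data (root_poly X) (root_poly B) N b f1 f2 f3 r1 r2 r3"
    and X: "\<And>r. r \<in> X \<Longrightarrow> \<exists>f1 f2 f3 r1 r2 r3. local_data (root_poly B) (root_poly X) M r f1 f2 f3 r1 r2 r3"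
  shows "4 * N ^ 4 + 2 * N ^ 3 - 10 * N\<^sup>2 - 4 * N - 1 = 0"
proof (rule ccontr)
  assume quartic: "4 * N ^ 4 + 2 * N ^ 3 - 10 * N\<^sup>2 - 4 * N - 1 \<noteq> 0"
  define f where "f = root_poly X"
  define g where "g = root_poly B"
  have deg: "degree f = card X" "degree g = card B" by (simp_all add: f_def g_def)
  have MN: "2 * M * N = - 1" using NM by (simp add: mult_ac)
  note W0 = second_order_identity[OF fin(1-4) _ B X, folded f_def g_def]
  have W: "third_order_form f g (N * (N + 1)) (N * (N + 1) + 3) (M * (M + 1) + 3) (M * (M + 1)) = 0"
  proof -
    have "third_order_form f g (N * (N + 1)) (N * (N + 1) + 3) (M * (M + 1) + 3) (M * (M + 1))
      = pderiv (smult (N * (N + 1)) (f * pderiv (pderiv g)) + smult 3 (pderiv f * pderiv g)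
         + smult (M * (M + 1)) (pderiv (pderiv f) * g))"
      unfolding third_order_form_def
      by (simp add: pderiv_add pderiv_smult pderiv_mult smult_add_left smult_add_right algebra_simps)
    then show ?thesis using W0 fin(5) by simp
  qed
  then have W': "third_order_form g f (M * (M + 1)) (M * (M + 1) + 3) (N * (N + 1) + 3) (N * (N + 1)) = 0"
    by (subst third_order_form_swap)
  define Y where "Y = third_order_form f g (bil1 N M) (bil2 N M) (- bil2 M N) (- bil1 M N)"
  have Y0: "Y = 0"
  proof (rule poly_eq_0_of_many_roots[OF fin(1-3)])
    show "degree Y < card X + card B"
      unfolding Y_def using degree_third_order_form[of f g] deg fin(4,5) by simp
  next
    fix b assume "b \<in> B"
    then obtain f1 f2 f3 r1 r2 r3 where ld: "local_data f g N b f1 f2 f3 r1 r2 r3"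
      using B unfolding f_def g_def by blast
    show "poly Y b = 0" unfolding Y_def by (rule third_order_vanishing[OF NM size(1) ld W])
  next
    fix r assume "r \<in> X"
    then obtain f1 f2 f3 r1 r2 r3 where ld: "local_data g f M r f1 f2 f3 r1 r2 r3"
      using X unfolding f_def g_def by blast
    \<comment> \<open>Exchanging f and g reverses the order of the coefficients; by their
      antisymmetry only the sign changes, and the result for roots of g applies.\<close>
    have "Y = - third_order_form g f (bil1 M N) (bil2 M N) (- bil2 N M) (- bil1 N M)"
      unfolding Y_def third_order_form_minus[symmetric] by (subst third_order_form_swap) simp
    moreover have "poly (third_order_form g f (bil1 M N) (bil2 M N) (- bil2 N M) (- bil1 N M)) r = 0"
      by (rule third_order_vanishing[OF MN size(2) ld W'])
    ultimately show "poly Y r = 0" by simp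
  qed
  have "poly (pderiv (pderiv g)) b = 0" if "b \<in> B" for b
  proof -
    obtain f1 f2 f3 r1 r2 r3 where ld: "local_data f g N b f1 f2 f3 r1 r2 r3"
      using B \<open>b \<in> B\<close> unfolding f_def g_def by blast
    have nz: "poly f b * poly (pderiv g) b \<noteq> 0" using ld unfolding local_data_def by simp
    obtain s k where sk: "r1 = 3 * s" "f1 = - 2 * N * (N + 1) * s" "s\<^sup>2 = (3 * N + 1) * (4 * N - 1) * k"
      "2 * r2 = 3 * (4 * N + 1) * (6 * N\<^sup>2 + 13 * N - 3) * k"
      "f2 = 6 * N ^ 3 * (N\<^sup>2 - 1) * (4 * N + 3) * k"
      by (rule third_order_vanishing[OF NM size(1) ld W])
    have w2: "24 * (N * (N + 1)) * r3 + 6 * (2 * (N * (N + 1)) + 3) * f1 * r2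
       + 4 * (N * (N + 1) + M * (M + 1) + 6) * f2 * r1 + 6 * (2 * (M * (M + 1)) + 3) * f3 = 0"
    proof -
      have "24 * (N * (N + 1)) * r3 + 6 * (N * (N + 1) + (N * (N + 1) + 3)) * f1 * r2
       + 4 * (N * (N + 1) + 3 + (M * (M + 1) + 3)) * f2 * r1 + 6 * (M * (M + 1) + 3 + M * (M + 1)) * f3 = 0"
        using poly_pderiv_third_order_form[OF ld, of "N * (N + 1)" "N * (N + 1) + 3" "M * (M + 1) + 3" "M * (M + 1)"] nz
        unfolding W by simp
      moreover have "N * (N + 1) + (N * (N + 1) + 3) = 2 * (N * (N + 1)) + 3"
        "N * (N + 1) + 3 + (M * (M + 1) + 3) = N * (N + 1) + M * (M + 1) + 6"
        "M * (M + 1) + 3 + M * (M + 1) = 2 * (M * (M + 1)) + 3" by simp_all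
      ultimately show ?thesis by (simp only:)
    qed
    have x2: "24 * bil1 N M * r3 + 6 * (bil1 N M + bil2 N M) * f1 * r2
       + 4 * (bil2 N M - bil2 M N) * f2 * r1 - 6 * (bil2 M N + bil1 M N) * f3 = 0"
    proof -
      have "24 * bil1 N M * r3 + 6 * (bil1 N M + bil2 N M) * f1 * r2
       + 4 * (bil2 N M + - bil2 M N) * f2 * r1 + 6 * (- bil2 M N + - bil1 M N) * f3 = 0"
        using poly_pderiv_third_order_form[OF ld, of "bil1 N M" "bil2 N M" "- bil2 M N" "- bil1 M N"] nz
        unfolding Y_def[symmetric] Y0 by simp
      moreover have "6 * (- bil2 M N + - bil1 M N) * f3 = - (6 * (bil2 M N + bil1 M N) * f3)"
        by (simp add: algebra_simps)
      ultimately show ?thesis by (simp only: add_uminus_conv_diff)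
    qed
    have e3: "4 * (N + 1) * (N + 2) * (N + 3) * (6 * N * r3 + 6 * N * (N - 1) * r1 * r2 + N * (N - 1) * (N - 2) * r1 ^ 3)
      = - 315 * (f1 ^ 3 - 2 * f1 * f2 + f3)"
      using ld unfolding local_data_def by blast
    have "r1 = 0"
      by (rule third_order_elimination[OF NM _ _ _ _ _ _ _ _ _ sk e3 w2 x2 quartic])
         (use size(1) N in \<open>simp_all add: good_size_def\<close>)
    then show ?thesis using ld unfolding local_data_def by simp
  qed
  then have "pderiv (pderiv g) = 0"
  proof (intro poly_eqI_degree[of B "pderiv (pderiv g)" 0])
    have "degree (pderiv (pderiv g)) \<le> card B - 1 - 1"
      using degree_pderiv_le[of g] degree_pderiv_le[of "pderiv g"] deg by linarith
    then show "degree (pderiv (pderiv g)) < card B" using fin(5) by linarith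
  qed (use fin(5) in auto)
  moreover have "coeff (pderiv (pderiv g)) (card B - 2) = (M - 1) * M"
  proof -
    obtain j where j: "card B = Suc (Suc j)" using fin(5) by (metis Suc_diff_le add_2_eq_Suc le_Suc_ex)
    have "coeff g (Suc (Suc j)) = 1" using lead_coeff_root_poly[of B] j by (simp add: g_def)
    then show ?thesis using j M(1) by (simp add: coeff_pderiv)
  qed
  ultimately show False using M(2) size(2) by (simp add: good_size_def)
qed

section \<open>Residues modulo a prime\<close>

lemma of_nat_mod_ring_nonzero:
  assumes "0 < k" "k < CARD('p::prime_card)"
  shows "of_nat k \<noteq> (0 :: 'p mod_ring)"
  using assms by (simp add: of_nat_eq_0_iff_char_dvd nat_dvd_not_less)

lemma numeral_mod_ring_nonzero:
  assumes "numeral k < CARD('p::prime_card)"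
  shows "numeral k \<noteq> (0 :: 'p mod_ring)"
  using of_nat_mod_ring_nonzero[of "numeral k", where ?'p = 'p] assms by simp

lemma power_half_cases:
  fixes x :: "'p::prime_card mod_ring"
  assumes "CARD('p) = 2 * d + 1" "x \<noteq> 0"
  shows "x ^ d = 1 \<or> x ^ d = - 1"
proof -
  have "x * x ^ (2 * d) = x * 1"
    using finite_field_power_card_eq_same[of x] assms(1) by simp
  then have "(x ^ d)\<^sup>2 = 1" using assms(2) by (simp add: power_even_eq)
  then show ?thesis by (simp add: power2_eq_1_iff)
qed

lemma minus_one_neq_one:
  assumes "CARD('p::prime_card) = 2 * d + 1"
  shows "(- 1 :: 'p mod_ring) \<noteq> 1"
proof
  assume "(- 1 :: 'p mod_ring) = 1"
  then have "(2 :: 'p mod_ring) = 0" by (metis add.right_inverse one_add_one)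
  moreover have "CARD('p) > 2"
    using assms prime_gt_1_nat[OF prime_card[where ?'a = 'p]] by presburger
  ultimately show False using numeral_mod_ring_nonzero[of "Num.Bit0 Num.One", where ?'p = 'p] by simp
qed

text \<open>The residues are among the at most \<open>d\<close> roots of x^d - 1. Squaring is at
  most two-to-one on the 2 d nonzero elements, so there are at least \<open>d\<close>
  residues.\<close>

lemma quadratic_residues_eq:
  assumes p: "CARD('p::prime_card) = 2 * d + 1"
  shows "quadratic_residues = {x :: 'p mod_ring. x ^ d = 1}"
    and "card (quadratic_residues :: 'p mod_ring set) = d"
proof -
  let ?R = "quadratic_residues :: 'p mod_ring set"
  have d: "d > 0" using p prime_gt_1_nat[OF prime_card[where ?'a = 'p]] by simp
  have sub: "?R \<subseteq> {x. x ^ d = 1}"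
  proof
    fix x :: "'p mod_ring" assume "x \<in> ?R"
    then obtain y where y: "x = y\<^sup>2" "y \<noteq> 0" by (auto simp: quadratic_residues_def)
    have "x ^ d = (y ^ d)\<^sup>2" unfolding y(1) by (metis power_even_eq power_mult)
    then show "x \<in> {x. x ^ d = 1}" using power_half_cases[OF p y(2)] by auto
  qed
  have "monom 1 d - 1 \<noteq> (0 :: 'p mod_ring poly)"
  proof
    assume "monom 1 d - 1 = (0 :: 'p mod_ring poly)"
    then have "coeff (monom 1 d - 1 :: 'p mod_ring poly) d = 0" by simp
    then show False using d by (simp)
  qed
  then have "card {x. poly (monom 1 d - 1 :: 'p mod_ring poly) x = 0} \<le> degree (monom 1 d - 1 :: 'p mod_ring poly)"
    by (rule card_poly_roots_bound)
  also have "\<dots> \<le> d" by (intro degree_diff_le) (auto simp: degree_monom_eq)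
  finally have le: "card {x :: 'p mod_ring. x ^ d = 1} \<le> d" by (simp add: poly_monom)
  have "2 * d \<le> 2 * card ?R"
  proof -
    have "UNIV - {0 :: 'p mod_ring} \<subseteq> (\<Union>x\<in>?R. {y. y\<^sup>2 = x})"
      by (auto simp: quadratic_residues_def)
    then have "card (UNIV - {0 :: 'p mod_ring}) \<le> card (\<Union>x\<in>?R. {y. y\<^sup>2 = x})"
      by (intro card_mono) auto
    also have "\<dots> \<le> (\<Sum>x\<in>?R. card {y. y\<^sup>2 = x})" by (rule card_UN_le) simp
    also have "\<dots> \<le> (\<Sum>x\<in>?R. 2)"
    proof (rule sum_mono)
      fix x :: "'p mod_ring" assume "x \<in> ?R"
      then obtain y where "x = y\<^sup>2" by (auto simp: quadratic_residues_def)
      then have "{y. y\<^sup>2 = x} \<subseteq> {y, - y}" by (auto simp: power2_eq_iff)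
      then have "card {y. y\<^sup>2 = x} \<le> card {y, - y}" by (intro card_mono) auto
      also have "\<dots> \<le> 2" by (simp add: card_insert_if)
      finally show "card {y. y\<^sup>2 = x} \<le> 2" .
    qed
    finally show ?thesis using p by (simp add: card_Diff_singleton)
  qed
  then have "d \<le> card ?R" by simp
  then show "?R = {x. x ^ d = 1}" using sub le card_mono[OF _ sub] by (intro card_subset_eq) auto
  then show "card ?R = d" using le \<open>d \<le> card ?R\<close> by simp
qed

section \<open>Sets of at least three elements, not both of size three\<close>

lemma no_decomposition_generic:
  fixes X B :: "'p::prime_card mod_ring set"
  assumes p: "CARD('p) = 2 * (card X * card B) + 1"
    and pow: "\<forall>b\<in>B. \<forall>r\<in>X. (b - r) ^ (card X * card B) = 1"
    and n: "card X \<ge> 3" "card B \<ge> 3" "\<not> (card X = 3 \<and> card B = 3)"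
  shows False
proof -
  define n m d where "n = card X" and "m = card B" and "d = card X * card B"
  note defs = n_def[symmetric] m_def[symmetric]
  have p': "CARD('p) = 2 * d + 1" using p by (simp add: d_def)
  have d: "n * m = d" by (simp add: n_def m_def d_def)
  have dn: "3 * n \<le> d" and dm: "3 * m \<le> d" using n d unfolding defs by auto
  have n3: "n \<ge> 3" "m \<ge> 3" using n by (simp_all add: n_def m_def)
  define N M where "N = (of_nat n :: 'p mod_ring)" and "M = (of_nat m :: 'p mod_ring)"
  have nz: "of_nat k \<noteq> (0 :: 'p mod_ring)" if "0 < k" "k < 2 * d + 1" for k
    using of_nat_mod_ring_nonzero[of k, where ?'p = 'p] that p' by simp
  have D: "2 * of_nat d = (- 1 :: 'p mod_ring)"
  proof -
    have "of_nat (2 * d + 1) = (0 :: 'p mod_ring)" unfolding p'[symmetric] by simp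
    then have "2 * of_nat d + 1 = (0 :: 'p mod_ring)" by (simp add: add.commute)
    then show ?thesis by (metis eq_neg_iff_add_eq_0)
  qed
  then have NM: "2 * N * M = - 1" unfolding N_def M_def d[symmetric] by (simp add: mult.assoc)
  have fin: "finite X" "finite B" "X \<noteq> {}" "B \<noteq> {}" using n by auto
  have disj: "X \<inter> B = {}"
  proof (rule ccontr)
    assume "X \<inter> B \<noteq> {}"
    then obtain x where "x \<in> X" "x \<in> B" by auto
    then have "(x - x) ^ (card X * card B) = 1" using pow by blast
    moreover have "d > 0" using dn n3 by linarith
    ultimately show False by (simp add: defs d power_0_left)
  qed
  \<comment> \<open>Each quantity is the image of a natural number between 1 and 2 d; the largest, 4
    k + 1, is controlled by \<open>3 * k \<le> d\<close>.\<close>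
  have gen: "good_size (of_nat k :: 'p mod_ring) \<and> (of_nat k - 1 :: 'p mod_ring) \<noteq> 0 \<and>
      (4 * of_nat k + 1 :: 'p mod_ring) \<noteq> 0 \<and> (2 * of_nat k - 1 :: 'p mod_ring) \<noteq> 0 \<and>
      (k > 3 \<longrightarrow> (of_nat k - 3 :: 'p mod_ring) \<noteq> 0)"
    if k: "k \<ge> 3" "3 * k \<le> d" for k
  proof -
    have "of_nat 2 \<noteq> (0 :: 'p mod_ring)" "of_nat 3 \<noteq> (0 :: 'p mod_ring)" "of_nat 5 \<noteq> (0 :: 'p mod_ring)"
      "of_nat k \<noteq> (0 :: 'p mod_ring)" "of_nat (k + 1) \<noteq> (0 :: 'p mod_ring)" "of_nat (k - 2) \<noteq> (0 :: 'p mod_ring)"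
      "of_nat (3 * k + 1) \<noteq> (0 :: 'p mod_ring)" "of_nat (4 * k - 1) \<noteq> (0 :: 'p mod_ring)"
      "of_nat (k - 1) \<noteq> (0 :: 'p mod_ring)" "of_nat (4 * k + 1) \<noteq> (0 :: 'p mod_ring)"
      "of_nat (2 * k - 1) \<noteq> (0 :: 'p mod_ring)" "k > 3 \<longrightarrow> of_nat (k - 3) \<noteq> (0 :: 'p mod_ring)"
      by (intro impI nz; use k in linarith)+
    then show ?thesis using k unfolding good_size_def by (simp add: of_nat_diff add.commute)
  qed
  note gN = gen[OF n3(1) dn, folded N_def] and gM = gen[OF n3(2) dm, folded M_def]
  have ldB: "\<exists>f1 f2 f3 r1 r2 r3. local_data (root_poly X) (root_poly B) N b f1 f2 f3 r1 r2 r3" if "b \<in> B" for b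
    unfolding N_def n_def
    by (rule local_data_exists[where d = d and \<eta> = 1])
      (use fin disj that D pow d dn n3 nz in \<open>auto simp: defs d_def[symmetric]\<close>)
  have ldX: "\<exists>f1 f2 f3 r1 r2 r3. local_data (root_poly B) (root_poly X) M r f1 f2 f3 r1 r2 r3" if "r \<in> X" for r
    unfolding M_def m_def
  \<comment> \<open>Exchanging the two sets negates the differences, hence the constant.\<close>
  proof (rule local_data_exists[where d = d and \<eta> = "(- 1) ^ d"])
    show "\<forall>b\<in>X. \<forall>r\<in>B. (b - r) ^ d = (- 1) ^ d"
    proof (intro ballI)
      fix x b assume "x \<in> X" "b \<in> B"
      then have "(b - x) ^ d = 1" using pow by (simp add: d_def)
      moreover have "x - b = - 1 * (b - x)" by simp
      ultimately show "(x - b) ^ d = (- 1) ^ d" by (metis power_mult_distrib mult_1_right)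
    qed
  qed (use fin disj that D d dm n3 nz in \<open>auto simp: defs d_def[symmetric] mult.commute\<close>)
  have MN: "2 * M * N = - 1" using NM by (simp add: mult_ac)
  have cd: "card X > 0" "card B > 0" "card X \<ge> 2" "card B \<ge> 2" using n by auto
  have disj': "B \<inter> X = {}" using disj by blast
  have qN: "4 * N ^ 4 + 2 * N ^ 3 - 10 * N\<^sup>2 - 4 * N - 1 = 0" if "n > 3"
    by (rule quartic_vanishes[OF fin(1,2) disj cd(1,4) NM _ _ _ _ _ _ _ _ ldB ldX])
      (use gN gM that in \<open>auto simp: M_def m_def\<close>)
  have qM: "4 * M ^ 4 + 2 * M ^ 3 - 10 * M\<^sup>2 - 4 * M - 1 = 0" if "m > 3"
    by (rule quartic_vanishes[OF fin(2,1) disj' cd(2,3) MN _ _ _ _ _ _ _ _ ldX ldB])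
      (use gN gM that in \<open>auto simp: N_def n_def\<close>)
  have num: "(2 :: 'p mod_ring) \<noteq> 0" "(5 :: 'p mod_ring) \<noteq> 0" using gN by (auto simp: good_size_def)
  \<comment> \<open>The quartic times 6^4/4 is a polynomial in 6 K; at 6 K = -1 its value is
    -200.\<close>
  have three: False if "6 * K = - 1" "4 * K ^ 4 + 2 * K ^ 3 - 10 * K\<^sup>2 - 4 * K - 1 = 0" for K :: "'p mod_ring"
  proof -
    have "324 * (4 * K ^ 4 + 2 * K ^ 3 - 10 * K\<^sup>2 - 4 * K - 1)
      = (6 * K) ^ 4 + 3 * (6 * K) ^ 3 - 90 * (6 * K)\<^sup>2 - 216 * (6 * K) - 324" by Groebner_Basis.algebra
    then have "(200 :: 'p mod_ring) = 0" unfolding that by simp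
    moreover have "(200 :: 'p mod_ring) = 2 * 2 * 2 * 5 * 5" by simp
    ultimately show False using num by (simp only: mult_eq_0_iff) blast
  qed
  consider "n > 3" "m > 3" | "n = 3" "m > 3" | "n > 3" "m = 3"
    using n n3 unfolding defs by linarith
  then show False
  proof cases
    case 1
    \<comment> \<open>Multiplied by 4 N^4, the quartic in M becomes one in N; adding the quartic in
      N cancels the terms of degree 4.\<close>
    have "10 * N\<^sup>2 * (N + M - 2) = 0"
    proof -
      have "4 * N ^ 4 * (4 * M ^ 4 + 2 * M ^ 3 - 10 * M\<^sup>2 - 4 * M - 1)
        = (2 * N * M) ^ 4 + N * (2 * N * M) ^ 3 - 10 * N\<^sup>2 * (2 * N * M)\<^sup>2 - 8 * N ^ 3 * (2 * N * M) - 4 * N ^ 4"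
        by Groebner_Basis.algebra
      then have "1 - N - 10 * N\<^sup>2 + 8 * N ^ 3 - 4 * N ^ 4 = 0" unfolding NM qM[OF 1(2)] by simp
      moreover have "10 * N\<^sup>2 * (N + M - 2) = (1 - N - 10 * N\<^sup>2 + 8 * N ^ 3 - 4 * N ^ 4)
          + (4 * N ^ 4 + 2 * N ^ 3 - 10 * N\<^sup>2 - 4 * N - 1) + 5 * N * (2 * N * M + 1)" by Groebner_Basis.algebra
      ultimately show ?thesis unfolding NM qN[OF 1(1)] by simp
    qed
    moreover have "N + M - 2 \<noteq> 0"
    proof -
      have "n + m \<le> d" using dn dm n3 by linarith
      then have "of_nat (n + m - 2) \<noteq> (0 :: 'p mod_ring)" using n3 by (intro nz) auto
      then show ?thesis using n3 by (simp add: N_def M_def of_nat_diff)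
    qed
    moreover have "(10 :: 'p mod_ring) = 2 * 5" by simp
    then have "(10 :: 'p mod_ring) \<noteq> 0" using num by (simp only: mult_eq_0_iff) blast
    moreover have "N \<noteq> 0" using gN by (simp add: good_size_def)
    ultimately show False by simp
  next
    case 2
    then have "6 * M = - 1" using NM by (simp add: N_def)
    then show False using three qM 2 by blast
  next
    case 3
    then have "6 * N = - 1" using MN by (simp add: M_def)
    then show False using three qN 3 by blast
  qed
qed

section \<open>Two sets of three elements modulo 19\<close>

lemma no_decomposition_three:
  fixes A B :: "'p::prime_card mod_ring set"
  assumes p: "CARD('p) = 19" and R: "quadratic_residues = A + B"
    and inj: "inj_on (\<lambda>(a, b). a + b) (A \<times> B)" and "card A = 3" "card B = 3"
  shows False
proof -
  let ?R = "quadratic_residues :: 'p mod_ring set"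
  have nz: "numeral k \<noteq> (0 :: 'p mod_ring)" if "numeral k < (19::nat)" for k
    using numeral_mod_ring_nonzero[of k, where ?'p = 'p] that p by simp
  have z: "of_nat (19 * k) = (0 :: 'p mod_ring)" for k
    using p by (simp only: of_nat_eq_0_iff_char_dvd) simp
  \<comment> \<open>Multiplication by the square 4 permutes the residues and multiplies the power
    sum by 4^j.\<close>
  have ps: "(\<Sum>x\<in>?R. x ^ j) = 0" if "(4 ^ j - 1 :: 'p mod_ring) \<noteq> 0" for j
  proof -
    have four: "(4 :: 'p mod_ring) \<noteq> 0" by (rule nz) simp
    have "(\<lambda>x. 4 * x) ` ?R \<subseteq> ?R"
    proof
      fix w assume "w \<in> (\<lambda>x. 4 * x) ` ?R"
      then obtain x where "w = 4 * x" "x \<in> ?R" by blast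
      moreover from this obtain y where "x = y\<^sup>2" "y \<noteq> 0" unfolding quadratic_residues_def by auto
      ultimately have "w \<noteq> 0" "w = (2 * y)\<^sup>2" using four by (auto simp: power2_eq_square)
      then show "w \<in> ?R" unfolding quadratic_residues_def by blast
    qed
    moreover have inj4: "inj_on (\<lambda>x. 4 * x) ?R" using four by (auto intro: inj_onI)
    ultimately have "(\<lambda>x. 4 * x) ` ?R = ?R" by (intro card_subset_eq) (auto simp: card_image)
    then have "(\<Sum>x\<in>?R. x ^ j) = (\<Sum>x\<in>(\<lambda>x. 4 * x) ` ?R. x ^ j)" by simp
    also have "\<dots> = 4 ^ j * (\<Sum>x\<in>?R. x ^ j)"
      by (simp add: sum.reindex[OF inj4] power_mult_distrib sum_distrib_left)
    finally have "(4 ^ j - 1) * (\<Sum>x\<in>?R. x ^ j) = 0" by (simp add: algebra_simps)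
    then show ?thesis using that by simp
  qed
  have sums: "(\<Sum>a\<in>A. \<Sum>b\<in>B. (a + b) ^ j) = 0" if "(4 ^ j - 1 :: 'p mod_ring) \<noteq> 0" for j
  proof -
    have "?R = (\<lambda>(a, b). a + b) ` (A \<times> B)" unfolding R by (auto simp: set_plus_def)
    then have "0 = (\<Sum>x\<in>(\<lambda>(a, b). a + b) ` (A \<times> B). x ^ j)" using ps[OF that] by simp
    also have "\<dots> = (\<Sum>(a, b)\<in>A \<times> B. (a + b) ^ j)"
      unfolding sum.reindex[OF inj] by (rule sum.cong) auto
    also have "\<dots> = (\<Sum>a\<in>A. \<Sum>b\<in>B. (a + b) ^ j)" by (simp add: sum.cartesian_product)
    finally show ?thesis by simp
  qed
  obtain a1 a2 a3 where A: "A = {a1, a2, a3}" "a1 \<noteq> a2" "a1 \<noteq> a3" "a2 \<noteq> a3"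
    using \<open>card A = 3\<close> by (auto simp: card_3_iff)
  obtain b1 b2 b3 where B: "B = {b1, b2, b3}" "b1 \<noteq> b2" "b1 \<noteq> b3" "b2 \<noteq> b3"
    using \<open>card B = 3\<close> by (auto simp: card_3_iff)
  have q: "(4 ^ 1 - 1 :: 'p mod_ring) \<noteq> 0" "(4 ^ 2 - 1 :: 'p mod_ring) \<noteq> 0" "(4 ^ 3 - 1 :: 'p mod_ring) \<noteq> 0"
    "(4 ^ 4 - 1 :: 'p mod_ring) \<noteq> 0"
  proof -
    show "(4 ^ 1 - 1 :: 'p mod_ring) \<noteq> 0" using nz[of "Num.Bit1 Num.One"] by simp
    have "(15 :: 'p mod_ring) \<noteq> 0" by (rule nz) simp
    then show "(4 ^ 2 - 1 :: 'p mod_ring) \<noteq> 0" by simp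
    have "(63 :: 'p mod_ring) = of_nat (19 * 3) + 6" "(255 :: 'p mod_ring) = of_nat (19 * 13) + 8" by simp_all
    then have "(63 :: 'p mod_ring) = 6" "(255 :: 'p mod_ring) = 8" unfolding z by simp_all
    moreover have "(6 :: 'p mod_ring) \<noteq> 0" "(8 :: 'p mod_ring) \<noteq> 0" by (rule nz, simp)+
    ultimately show "(4 ^ 3 - 1 :: 'p mod_ring) \<noteq> 0" "(4 ^ 4 - 1 :: 'p mod_ring) \<noteq> 0" by simp_all
  qed
  have three: "(3 :: 'p mod_ring) \<noteq> 0" by (rule nz) simp
  \<comment> \<open>Shifting A by -s and B by s preserves all sums and centres A; the first power
    sum then shows that B is centred too.\<close>
  define s where "s = (a1 + a2 + a3) / 3"
  have s: "3 * s = a1 + a2 + a3" using three by (simp add: s_def)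
  define x y u v where "x = a1 - s" and "y = a2 - s" and "u = b1 + s" and "v = b2 + s"
  have a: "a1 = x + s" "a2 = y + s" "a3 = - x - y + s" using s by (auto simp: x_def y_def algebra_simps)
  have S1: "3 * (a1 + a2 + a3) + 3 * (b1 + b2 + b3) = 0"
    using sums[OF q(1)] A B by (simp add: algebra_simps)
  then have "3 * ((a1 + a2 + a3) + (b1 + b2 + b3)) = 0" by (simp add: algebra_simps)
  then have "(a1 + a2 + a3) + (b1 + b2 + b3) = 0" using three by (simp only: mult_eq_0_iff) blast
  then have b: "b1 = u - s" "b2 = v - s" "b3 = - u - v - s"
    unfolding s[symmetric] u_def v_def by (simp_all, Groebner_Basis.algebra)
  have e: "(\<Sum>a\<in>A. \<Sum>b\<in>B. (a + b) ^ j) =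
     (x + u) ^ j + (x + v) ^ j + (x - u - v) ^ j + (y + u) ^ j + (y + v) ^ j + (y - u - v) ^ j
     + (- x - y + u) ^ j + (- x - y + v) ^ j + (- x - y - u - v) ^ j" for j
  proof -
    have "(\<Sum>a\<in>A. \<Sum>b\<in>B. (a + b) ^ j) =
      ((a1 + b1) ^ j + (a1 + b2) ^ j + (a1 + b3) ^ j) + ((a2 + b1) ^ j + (a2 + b2) ^ j + (a2 + b3) ^ j)
      + ((a3 + b1) ^ j + (a3 + b2) ^ j + (a3 + b3) ^ j)"
      unfolding A(1) B(1) using A(2-4) B(2-4) by (simp add: add.assoc)
    moreover have "a1 + b1 = x + u" "a1 + b2 = x + v" "a1 + b3 = x - u - v" "a2 + b1 = y + u" "a2 + b2 = y + v"
      "a2 + b3 = y - u - v" "a3 + b1 = - x - y + u" "a3 + b2 = - x - y + v" "a3 + b3 = - x - y - u - v"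
      unfolding a b by (simp_all add: algebra_simps)
    ultimately show ?thesis by (simp add: add.assoc)
  qed
  define P Q where "P = x\<^sup>2 + x * y + y\<^sup>2" and "Q = u\<^sup>2 + u * v + v\<^sup>2"
  have "6 * (P + Q) = 0"
    using sums[OF q(2)] unfolding e P_def Q_def by Groebner_Basis.algebra
  moreover have six: "(6 :: 'p mod_ring) \<noteq> 0" by (rule nz) simp
  ultimately have "P + Q = 0" by (simp only: mult_eq_0_iff) blast
  then have PQ: "Q = - P" by (simp add: eq_neg_iff_add_eq_0 add.commute)
  have "9 * (x * y * (x + y) + u * v * (u + v)) = 0"
    using sums[OF q(3)] unfolding e by Groebner_Basis.algebra
  moreover have "(9 :: 'p mod_ring) \<noteq> 0" by (rule nz) simp
  ultimately have e3: "x * y * (x + y) + u * v * (u + v) = 0" by (simp only: mult_eq_0_iff) blast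
  have "6 * (P\<^sup>2 + Q\<^sup>2 + 4 * P * Q) = 0"
    using sums[OF q(4)] unfolding e P_def Q_def by Groebner_Basis.algebra
  then have "12 * P\<^sup>2 = 0" unfolding PQ by (simp add: power2_eq_square)
  moreover have "(12 :: 'p mod_ring) \<noteq> 0" by (rule nz) simp
  ultimately have P: "P = 0" by simp
  then have Q: "Q = 0" using PQ by simp
  \<comment> \<open>With P = Q = 0 the shifted sets are the roots of t^3 + c and t^3 - c, c = x y (x
    + y), so each is the negative of the other.\<close>
  have "(x + u) * (x + v) * (x - u - v) = 0"
    using P Q e3 unfolding P_def Q_def by Groebner_Basis.algebra
  then have "x + u = 0 \<or> x + v = 0 \<or> x - u - v = 0" by (simp only: mult_eq_0_iff) blast
  moreover have "a1 + b1 = x + u" "a1 + b2 = x + v" "a1 + b3 = x - u - v"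
    unfolding a b by (simp_all add: algebra_simps)
  ultimately have "a1 + b1 = 0 \<or> a1 + b2 = 0 \<or> a1 + b3 = 0" by simp
  then have "0 \<in> ?R" unfolding R A(1) B(1) by (auto simp: set_plus_def)
  then show False by (simp add: quadratic_residues_def)
qed

section \<open>A set of two elements\<close>

text \<open>\<open>\<alpha>\<close> marks the lower elements of pairs {x, x + 1} that make up the
  nonresidues. The least nonresidue must be 2, and multiplicativity then forces a contradiction at
  16.\<close>

lemma no_pairing_of_nonresidues:
  fixes \<alpha> :: "'p::prime_card mod_ring \<Rightarrow> bool"
  assumes p: "CARD('p) = 2 * d + 1" "d \<ge> 3"
    and N: "\<And>x. x ^ d = - 1 \<longleftrightarrow> \<alpha> x \<or> \<alpha> (x - 1)" and dj: "\<And>x. \<not> (\<alpha> x \<and> \<alpha> (x - 1))"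
  shows False
proof -
  define \<chi> where "\<chi> k = (of_nat k :: 'p mod_ring) ^ d" for k
  have \<chi>_mult: "\<chi> (j * k) = \<chi> j * \<chi> k" for j k by (simp add: \<chi>_def power_mult_distrib)
  have neq: "(- 1 :: 'p mod_ring) \<noteq> 1" by (rule minus_one_neq_one[OF p(1)])
  have \<chi>_cases: "\<chi> k = 0 \<or> \<chi> k = 1 \<or> \<chi> k = - 1" for k
    using power_half_cases[OF p(1), of "of_nat k"] p(2) by (cases "of_nat k = (0 :: 'p mod_ring)") (auto simp: \<chi>_def)
  have \<chi>_nz: "\<chi> k \<noteq> 0" if "0 < k" "k \<le> 6" for k
    using of_nat_mod_ring_nonzero[of k, where ?'p = 'p] that p by (simp add: \<chi>_def)
  have Nk: "\<chi> k = - 1 \<longleftrightarrow> \<alpha> (of_nat k) \<or> \<alpha> (of_nat k - 1)" for k unfolding \<chi>_def by (rule N)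
  \<comment> \<open>The first nonresidue after a gap can only be the lower element of a
    pair.\<close>
  have step: "\<chi> (k + 2) = - 1" if "\<chi> (k + 1) = - 1" "\<chi> k \<noteq> - 1" for k
  proof -
    have "\<alpha> (of_nat (k + 1))" using that Nk[of "k + 1"] Nk[of k] by simp
    moreover have "of_nat (k + 2) - 1 = (of_nat (k + 1) :: 'p mod_ring)" by simp
    ultimately show ?thesis using Nk[of "k + 2"] by simp
  qed
  have "\<exists>k. \<chi> k = - 1"
  proof (rule ccontr)
    assume "\<nexists>k. \<chi> k = - 1"
    then have no: "\<chi> k \<noteq> - 1" for k by blast
    have "x ^ d = 1" if "x \<noteq> 0" for x :: "'p mod_ring"
    proof -
      obtain k where "x = of_nat k" using surj_of_nat_mod_ring by blast
      then show ?thesis using no[of k] power_half_cases[OF p(1) that] unfolding \<chi>_def by blast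
    qed
    then have "UNIV - {0 :: 'p mod_ring} \<subseteq> quadratic_residues"
      unfolding quadratic_residues_eq(1)[OF p(1)] by blast
    then have "card (UNIV - {0 :: 'p mod_ring}) \<le> card (quadratic_residues :: 'p mod_ring set)"
      by (intro card_mono) auto
    then show False unfolding quadratic_residues_eq(2)[OF p(1)] using p by (simp add: card_Diff_singleton)
  qed
  define q where "q = (LEAST k. \<chi> k = - 1)"
  have q: "\<chi> q = - 1" unfolding q_def using \<open>\<exists>k. \<chi> k = - 1\<close> by (rule LeastI_ex)
  have least: "\<chi> k \<noteq> - 1" if "k < q" for k using that unfolding q_def by (rule not_less_Least)
  have "\<chi> 0 = 0" using p(2) by (simp add: \<chi>_def power_0_left)
  then have "q \<noteq> 0" using q by (metis neg_equal_0_iff_equal zero_neq_one)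
  have \<chi>1: "\<chi> 1 = 1" by (simp add: \<chi>_def)
  have "q \<noteq> 1" using q \<chi>1 neq by auto
  \<comment> \<open>One of \<open>q\<close> and \<open>q + 1\<close> is even; if q > 2, it is a
    product of two numbers below \<open>q\<close>, so it cannot be a nonresidue.\<close>
  have mul: "\<chi> (2 * j) \<noteq> - 1" if "2 < q" "j < q" for j
    using \<chi>_mult[of 2 j] least[OF that(1)] least[OF that(2)] \<chi>_cases[of 2] \<chi>_cases[of j] neq by auto
  have "\<chi> (Suc q) = - 1"
  proof -
    obtain k where "q = k + 1" using \<open>q \<noteq> 0\<close> by (metis Suc_eq_plus1 not0_implies_Suc)
    then show ?thesis using step[of k] q least[of k] by simp
  qed
  have "\<not> 2 < q"
  proof
    assume "2 < q"
    show False
    proof (cases "even q")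
      case True
      then obtain j where "q = 2 * j" by (elim evenE)
      then show False using mul[of j] q \<open>2 < q\<close> by auto
    next
      case False
      then have "even (Suc q)" by simp
      then obtain j where j: "Suc q = 2 * j" by (elim evenE)
      then have "j < q" using \<open>2 < q\<close> by linarith
      then show False using mul[of j] j \<open>2 < q\<close> \<open>\<chi> (Suc q) = - 1\<close> by simp
    qed
  qed
  then have "q = 2" using \<open>q \<noteq> 0\<close> \<open>q \<noteq> 1\<close> by linarith
  have 2: "\<chi> 2 = - 1" and 3: "\<chi> 3 = - 1"
    using q \<open>\<chi> (Suc q) = - 1\<close> unfolding \<open>q = 2\<close> by simp_all
  have 4: "\<chi> 4 = 1" and 6: "\<chi> 6 = 1" and 9: "\<chi> 9 = 1"
    using \<chi>_mult[of 2 2] \<chi>_mult[of 2 3] \<chi>_mult[of 3 3] 2 3 by simp_all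
  have 8: "\<chi> 8 = - 1" and 16: "\<chi> 16 = 1"
    using \<chi>_mult[of 2 4] \<chi>_mult[of 4 4] 2 4 by simp_all
  have "\<chi> 5 \<noteq> - 1" using step[of 4] 4 6 neq by auto
  then have 5: "\<chi> 5 = 1" using \<chi>_cases[of 5] \<chi>_nz[of 5] by auto
  \<comment> \<open>8 is a nonresidue and 9 is not, so 8 is the upper element of its pair and 7 is
    the lower one.\<close>
  have "\<not> \<alpha> (of_nat 8)" using Nk[of 9] 9 neq by auto
  then have "\<alpha> (of_nat 7)" using Nk[of 8] 8 by simp
  then have 7: "\<chi> 7 = - 1" using Nk[of 7] by simp
  have 14: "\<chi> 14 = 1" using \<chi>_mult[of 2 7] 2 7 by simp
  have 15: "\<chi> 15 = - 1" using \<chi>_mult[of 3 5] 3 5 by simp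
  have "\<chi> 16 = - 1" using step[of 14] 14 15 neq by simp
  then show False using 16 neq by simp
qed

text \<open>For x = y^2 and x + 1 = z^2 put u = z + y; then 1/u = z - y. Each such x comes from the
  four values u, -u, 1/u, -1/u, none of which is among the five elements with u = 0 or u^2 = 1 or
  u^2 = -1.\<close>

lemma card_consecutive_residues_le:
  assumes p: "CARD('p::prime_card) = 4 * n + 1"
  shows "4 * card {x :: 'p mod_ring. x \<in> quadratic_residues \<and> x + 1 \<in> quadratic_residues} + 4 \<le> 4 * n"
proof -
  define P where "P = {x :: 'p mod_ring. x \<in> quadratic_residues \<and> x + 1 \<in> quadratic_residues}"
  have p2: "CARD('p) = 2 * (2 * n) + 1" using p by simp
  have neq: "(- 1 :: 'p mod_ring) \<noteq> 1" by (rule minus_one_neq_one[OF p2])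
  then have two: "(2 :: 'p mod_ring) \<noteq> 0"
    by (metis one_add_one eq_neg_iff_add_eq_0)
  have "(- 1 :: 'p mod_ring) \<in> quadratic_residues"
    unfolding quadratic_residues_eq(1)[OF p2] by simp
  then obtain i :: "'p mod_ring" where i: "i\<^sup>2 = - 1" by (auto simp: quadratic_residues_def)
  \<comment> \<open>The conditions u^2 \<noteq> 1 and u^2 \<noteq> -1 express y \<noteq> 0 and z
    \<noteq> 0.\<close>
  define U where "U = {u :: 'p mod_ring. u \<noteq> 0 \<and> u\<^sup>2 \<noteq> 1 \<and> u\<^sup>2 \<noteq> - 1}"
  define F where "F x = {u \<in> U. ((u - inverse u) / 2)\<^sup>2 = x}" for x
  have "card U + 5 \<le> CARD('p)"
  proof -
    have "i \<noteq> 0" "i \<noteq> 1" "i \<noteq> - 1" using i neq by auto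
    then have i0: "i \<noteq> 0" "i \<noteq> 1" "i \<noteq> - 1" "- i \<noteq> 1" by (auto simp: minus_equation_iff)
    have ii: "i \<noteq> - i" using i0(1) two by (metis add_eq_0_iff mult_2 mult_eq_0_iff)
    have "card {0, 1, - 1, i, - i} = 5"
      using i0 ii neq by (auto simp: card_insert_if)
    moreover have "U \<inter> {0, 1, - 1, i, - i} = {}" using i by (auto simp: U_def)
    ultimately have "card (U \<union> {0, 1, - 1, i, - i}) = card U + 5" by (subst card_Un_disjoint) auto
    moreover have "card (U \<union> {0, 1, - 1, i, - i}) \<le> card (UNIV :: 'p mod_ring set)" by (intro card_mono) auto
    ultimately show ?thesis by simp
  qed
  moreover have "4 * card P \<le> card U"
  proof -
    have "4 * card P = (\<Sum>x\<in>P. 4)" by simp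
    also have "\<dots> \<le> (\<Sum>x\<in>P. card (F x))"
    proof (rule sum_mono)
      fix x assume "x \<in> P"
      then obtain y z where y: "x = y\<^sup>2" "y \<noteq> 0" and z: "x + 1 = z\<^sup>2" "z \<noteq> 0"
        by (auto simp: P_def quadratic_residues_def)
      define u where "u = z + y"
      have uv: "u * (z - y) = 1" using y z unfolding u_def by (simp add: algebra_simps power2_eq_square)
      then have u0: "u \<noteq> 0" by auto
      have iu: "inverse u = z - y" using uv u0 by (metis inverse_unique)
      have "u - inverse u = 2 * y" "u + inverse u = 2 * z" unfolding iu by (simp_all add: u_def)
      then have d2: "(u - inverse u) / 2 = y" "(u + inverse u) / 2 = z" using two by simp_all
      have u1: "u\<^sup>2 \<noteq> 1"
      proof
        assume "u\<^sup>2 = 1"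
        then have "inverse u = u" using u0 by (metis inverse_unique power2_eq_square)
        then show False using d2(1) y(2) by simp
      qed
      have um1: "u\<^sup>2 \<noteq> - 1"
      proof
        assume "u\<^sup>2 = - 1"
        then have "u * (- u) = 1" by (simp add: power2_eq_square)
        then have "inverse u = - u" by (rule inverse_unique)
        then show False using d2(2) z(2) by simp
      qed
      have neg: "- w \<in> F x" if "w \<in> F x" for w
      proof -
        have "(- w - inverse (- w)) / 2 = - ((w - inverse w) / 2)" by (simp add: diff_divide_distrib)
        then have "((- w - inverse (- w)) / 2)\<^sup>2 = ((w - inverse w) / 2)\<^sup>2" by (simp only: power2_minus)
        then show ?thesis using that by (simp add: F_def U_def)
      qed
      have "((u - inverse u) / 2)\<^sup>2 = x" unfolding d2(1) y(1) ..
      then have u: "u \<in> F x" using u0 u1 um1 by (simp add: F_def U_def)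
      have inv: "inverse u \<in> F x"
      proof -
        have "inverse (u\<^sup>2) \<noteq> - 1" using um1 by (metis inverse_inverse_eq inverse_minus_eq inverse_1)
        moreover have "((inverse u - inverse (inverse u)) / 2)\<^sup>2 = ((u - inverse u) / 2)\<^sup>2"
          by (simp add: power_divide power2_commute)
        ultimately show ?thesis using u u1 by (simp add: F_def U_def power_inverse)
      qed
      have mem: "{u, - u, inverse u, - inverse u} \<subseteq> F x"
        using u inv neg by blast
      have "u \<noteq> - u" using u0 two by (metis add_eq_0_iff mult_2 mult_eq_0_iff)
      moreover have "u \<noteq> inverse u" using u1 u0 by (metis power2_eq_square right_inverse)
      moreover have "u \<noteq> - inverse u" using um1 u0
        by (metis mult_minus_right power2_eq_square right_inverse)
      moreover have "inverse u \<noteq> - inverse u" using \<open>u \<noteq> - u\<close> by (metis inverse_inverse_eq inverse_minus_eq)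
      moreover have "- u \<noteq> inverse u" using \<open>u \<noteq> - inverse u\<close> by (metis minus_minus)
      ultimately have "card {u, - u, inverse u, - inverse u} = 4" by (auto simp: card_insert_if)
      moreover have "card {u, - u, inverse u, - inverse u} \<le> card (F x)" using mem by (intro card_mono) auto
      ultimately show "4 \<le> card (F x)" by simp
    qed
    also have "\<dots> = card (\<Union>x\<in>P. F x)" by (subst card_UN_disjoint) (auto simp: F_def)
    also have "\<dots> \<le> card U" by (intro card_mono) (auto simp: F_def)
    finally show ?thesis .
  qed
  ultimately show ?thesis unfolding P_def[symmetric] using p by linarith
qed

text \<open>Dividing by t = b2 - b1 makes A + B a union of pairs {x, x + 1}. If t is a residue,
  there are \<open>card A\<close> consecutive pairs of residues, one more than possible; otherwise
  the nonresidues are paired.\<close>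

lemma no_decomposition_two:
  fixes A B :: "'p::prime_card mod_ring set"
  assumes p: "CARD('p) = 4 * card A + 1" "card A \<ge> 2" and R: "quadratic_residues = A + B"
    and inj: "inj_on (\<lambda>(a, b). a + b) (A \<times> B)" and "card B = 2"
  shows False
proof -
  define d where "d = 2 * card A"
  have p2: "CARD('p) = 2 * d + 1" using p by (simp add: d_def)
  obtain b1 b2 where B: "B = {b1, b2}" "b1 \<noteq> b2" using \<open>card B = 2\<close> by (auto simp: card_2_iff)
  define t where "t = b2 - b1"
  have t: "t \<noteq> 0" using B by (simp add: t_def)
  define \<alpha> where "\<alpha> x \<longleftrightarrow> t * x - b1 \<in> A" for x
  have \<alpha>': "\<alpha> (x - 1) \<longleftrightarrow> t * x - b2 \<in> A" for x
    unfolding \<alpha>_def t_def by (simp add: algebra_simps)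
  have dj: "\<not> (\<alpha> x \<and> \<alpha> (x - 1))" for x
  proof
    assume "\<alpha> x \<and> \<alpha> (x - 1)"
    then have "t * x - b1 \<in> A" "t * x - b2 \<in> A" using \<alpha>' \<alpha>_def by auto
    then show False using inj_onD[OF inj, of "(t * x - b1, b1)" "(t * x - b2, b2)"] B by auto
  qed
  have S: "(t * x) ^ d = 1 \<longleftrightarrow> \<alpha> x \<or> \<alpha> (x - 1)" for x
  proof -
    have "(t * x) ^ d = 1 \<longleftrightarrow> t * x \<in> A + B" using R quadratic_residues_eq(1)[OF p2] by auto
    also have "\<dots> \<longleftrightarrow> (\<exists>a\<in>A. t * x = a + b1) \<or> (\<exists>a\<in>A. t * x = a + b2)"
      unfolding B set_plus_def by blast
    also have "\<dots> \<longleftrightarrow> t * x - b1 \<in> A \<or> t * x - b2 \<in> A"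
      by (metis add_diff_cancel_right' diff_add_cancel)
    finally show ?thesis using \<alpha>'[of x] \<alpha>_def[of x] by blast
  qed
  show False
  proof (cases "t ^ d = 1")
    case True
    then have S': "x \<in> quadratic_residues \<longleftrightarrow> \<alpha> x \<or> \<alpha> (x - 1)" for x
      using S[of x] quadratic_residues_eq(1)[OF p2] by (auto simp: power_mult_distrib)
    have "card A = card {x. \<alpha> x}"
    proof (rule bij_betw_same_card[of "\<lambda>a. (a + b1) / t"])
      show "bij_betw (\<lambda>a. (a + b1) / t) A {x. \<alpha> x}"
        by (rule bij_betw_byWitness[of _ "\<lambda>x. t * x - b1"]) (use t in \<open>auto simp: \<alpha>_def\<close>)
    qed
    also have "\<dots> \<le> card {x :: 'p mod_ring. x \<in> quadratic_residues \<and> x + 1 \<in> quadratic_residues}"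
      by (intro card_mono) (auto simp: S')
    finally show False using card_consecutive_residues_le[OF p(1)] by linarith
  next
    case False
    then have tm: "t ^ d = - 1" using power_half_cases[OF p2 t] by auto
    have "x ^ d = - 1 \<longleftrightarrow> \<alpha> x \<or> \<alpha> (x - 1)" for x
    proof -
      have "- 1 * x ^ d = 1 \<longleftrightarrow> x ^ d = - 1" by (metis minus_minus mult_minus1)
      then show ?thesis using S[of x] unfolding power_mult_distrib tm by blast
    qed
    moreover have "d \<ge> 3" using p(2) by (simp add: d_def)
    ultimately show False using no_pairing_of_nonresidues[of d \<alpha>] p2 dj by blast
  qed
qed

section \<open>Reduction to the cases\<close>

theorem theorem3:
  shows "\<not> (\<exists>A B :: 'p::prime_card mod_ring set.
           card A > 1 \<and> card B > 1 \<and> quadratic_residues = A + B)"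
proof (rule notI, elim exE conjE)
  fix A B :: "'p mod_ring set"
  assume A: "card A > 1" and B: "card B > 1" and R: "quadratic_residues = A + B"
  have fin: "finite A" "finite B" by simp_all
  obtain b0 where b0: "b0 \<in> B" using B by (metis card.empty equals0I not_less_zero)
  have A0: "A \<noteq> {}" using A by auto
  have z: "(0 :: 'p mod_ring) \<notin> A + B" unfolding R[symmetric] by (simp add: quadratic_residues_def)
  \<comment> \<open>For p = 2 a set of two elements is the whole field, so 0 would be a sum.\<close>
  have "odd CARD('p)"
  proof (rule ccontr)
    assume "\<not> odd CARD('p)"
    then have "CARD('p) = 2" using prime_card[where ?'a = 'p] by (metis primes_dvd_imp_eq two_is_prime_nat)
    then have "card A = CARD('p mod_ring)" using A card_mono[of UNIV A] by simp
    then have "A = UNIV" by (metis card_subset_eq finite subset_UNIV)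
    then have "- b0 + b0 \<in> A + B" using b0 by (intro set_plus_intro) auto
    then show False using z by simp
  qed
  then obtain d where p: "CARD('p) = 2 * d + 1" by (elim oddE)
  have d: "d > 0" using p prime_gt_1_nat[OF prime_card[where ?'a = 'p]] by simp
  have cR: "card (A + B) = d" using quadratic_residues_eq(2)[OF p] R by simp
  \<comment> \<open>This bound gives card X + d < p, so the characteristic condition of the
    polynomial bound holds.\<close>
  have "card A \<le> d"
  proof -
    have "card ((\<lambda>a. a + b0) ` A) \<le> card (A + B)"
      using b0 by (intro card_mono) auto
    moreover have "card ((\<lambda>a. a + b0) ` A) = card A" by (intro card_image inj_onI) simp
    ultimately show ?thesis using cR by simp
  qed
  define X where "X = uminus ` A"
  have cX: "card X = card A" unfolding X_def by (intro card_image inj_onI) simp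
  have pow: "\<forall>b\<in>B. \<forall>r\<in>X. (b - r) ^ d = 1"
  proof (intro ballI)
    fix b r assume "b \<in> B" "r \<in> X"
    then have "b - r \<in> A + B" unfolding X_def by (auto simp: add.commute[of b] intro!: set_plus_intro)
    then show "(b - r) ^ d = 1" using R quadratic_residues_eq(1)[OF p] by auto
  qed
  have "card X * card B \<le> d"
  proof (rule card_mult_card_le_of_const_power(1)[of X B d 1])
    show "of_nat k \<noteq> (0 :: 'p mod_ring)" if "0 < k" "k < card X + d" for k
      using that cX \<open>card A \<le> d\<close> p by (intro of_nat_mod_ring_nonzero) auto
  qed (use d pow A0 in \<open>auto simp: X_def\<close>)
  moreover have AB: "A + B = (\<lambda>(a, b). a + b) ` (A \<times> B)" by (auto simp: set_plus_def)
  \<comment> \<open>The d residues are all sums. With the polynomial bound this gives equality,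
    hence every residue is a sum in one way only.\<close>
  then have "d \<le> card A * card B" unfolding cR[symmetric] by (metis card_cartesian_product card_image_le finite)
  ultimately have nm: "card A * card B = d" using cX by simp
  have inj: "inj_on (\<lambda>(a, b). a + b) (A \<times> B)"
    using cR nm unfolding AB by (intro eq_card_imp_inj_on) (auto simp: card_cartesian_product)
  have BA: "quadratic_residues = B + A" using R by (simp add: add.commute)
  have inj': "inj_on (\<lambda>(a, b). a + b) (B \<times> A)"
  proof (rule inj_onI)
    fix u v assume "u \<in> B \<times> A" "v \<in> B \<times> A" "(\<lambda>(a, b). a + b) u = (\<lambda>(a, b). a + b) v"
    then show "u = v"
      using inj_onD[OF inj, of "(snd u, fst u)" "(snd v, fst v)"] by (auto simp: add.commute)
  qed
  consider "card B = 2" | "card A = 2" | "card A = 3" "card B = 3"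
    | "card A \<ge> 3" "card B \<ge> 3" "\<not> (card A = 3 \<and> card B = 3)"
    using A B by linarith
  then show False
  proof cases
    case 1
    then show False using no_decomposition_two[OF _ _ R inj] p nm A by simp
  next
    case 2
    then show False using no_decomposition_two[OF _ _ BA inj'] p nm B by simp
  next
    case 3
    then show False using no_decomposition_three[OF _ R inj] p nm by simp
  next
    case 4
    then show False using no_decomposition_generic[of X B] p nm cX pow by simp
  qed
qed

end
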